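(* Let $g:\mathbb{R}^d\to[0,\infty)$ be Lipschitz continuous, $\alpha\in(0,1)$, $\lambda>0$, $L>0$. Let $P,Q\in\mathcal{P}(\mathbb{R}^d)$ satisfy $\mathbb{E}_P[g]<\infty$ and $\mathbb{E}_Q[g]<\infty$, and assume $Q$ has finite first moment. Let $$\mathcal{F}(Q;P)=D^L_{\mathrm{KL}}(Q\|P)+\lambda\,(\Delta C(Q;P))^2,\qquad \Delta C(Q;P)=\mathrm{CVaR}_\alpha^{P,g}-\mathrm{CVaR}_\alpha^{Q,g}.$$ Let $\phi^*$ be the maximizer of $\sup_{\phi\in\Gamma_L}\{\mathbb{E}_Q[\phi]-\log\mathbb{E}_P[e^\phi]\}$, where $\Gamma_L$ is the set of $L$-Lipschitz functions $\mathbb{R}^d\to\mathbb{R}$ (see the context). For $y\in\mathbb{R}$ let $h^y(x)=\frac{(g(x)-y)^+}{1-\alpha}$, and for each $y\in T(Q)=[\mathrm{VaR}_\alpha^{Q,g},\overline{\mathrm{VaR}}_\alpha^{Q,g}]$ define $$\Phi_Q^y:=\phi^*-2\lambda\,\Delta C(Q;P)\,h^y=\phi^*-\frac{2\lambda}{1-\alpha}\,\Delta C(Q;P)\,(g-y)^+ .$$ For a perturbation $\rho$ put $D^\pm_\rho\mathcal{F}(Q;P):=\lim_{\epsilon\to0^\pm}\frac1\epsilon\big(\mathcal{F}(Q+\epsilon\rho;P)-\mathcal{F}(Q;P)\big)$. Then: 1. For every right-admissible perturbation $\rho$ at $Q$, the right directional derivative exists and $$D^+_\rho\mathcal{F}(Q;P)=\int\phi^*\,d\rho-2\lambda\,\Delta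 C(Q;P)\min_{y\in T(Q)}\int h^y\,d\rho.$$ For every left-admissible perturbation $\rho$ at $Q$, the left directional derivative exists and $$D^-_\rho\mathcal{F}(Q;P)=\int\phi^*\,d\rho-2\lambda\,\Delta C(Q;P)\max_{y\in T(Q)}\int h^y\,d\rho.$$ 2. For any admissible $\rho$ at $Q$, the range of $y\mapsto\int\Phi_Q^y\,d\rho$ over $y\in T(Q)$ is the compact interval between $D^-_\rho\mathcal{F}(Q;P)$ and $D^+_\rho\mathcal{F}(Q;P)$. Consequently, every $\Phi_Q^y$ with $y\in T(Q)$ is a variational subgradient of $\mathcal{F}(\cdot;P)$ at $Q$. 3. Let $\rho$ be admissible at $Q$. The two-sided (Gateaux) derivative of $\mathcal{F}(\cdot;P)$ at $Q$ in direction $\rho$ exists if and only if $\Delta C(Q;P)=0$ or $y\mapsto\int h^y\,d\rho$ is constant on $T(Q)$. The two-sided derivative exists for every admissible perturbation if and only if $\Delta C(Q;P)=0$ or $T(Q)$ is a singleton; in that case $\mathcal{F}(\cdot;P)$ is Gateaux differentiable at $Q$ with first variational derivative $$\frac{\delta\mathcal{F}(Q;P)}{\delta Q}=\Phi_Q^{\mathrm{VaR}_\alpha^{Q,g}},$$ that is, the two-sided derivative in every admissible direction $\rho$ equals $\int\Phi_Q^{\mathrm{VaR}_\alpha^{Q,g}}\,d\rho$.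
   Context: $\mathcal{P}(\mathbb{R}^d)$ is the set of Borel probability measures on $\mathbb{R}^d$. $\mathcal{W}_1$ is the Wasserstein-1 metric. In the paper $P$ is the target distribution $P^{\mathrm{tar}}$ and $\mathcal{F}$ is denoted $\mathcal{F}^{\mathrm{CVaR}}$. Lipschitz-regularized KL divergence: $D^L_{\mathrm{KL}}(Q\|P)=\inf_{\gamma\in\mathcal{P}(\mathbb{R}^d)}\{D_{\mathrm{KL}}(\gamma\|P)+L\,\mathcal{W}_1(Q,\gamma)\}$. Known facts: $D^L_{\mathrm{KL}}(Q\|P)=\sup_{\phi\in\Gamma_L}\{\mathbb{E}_Q[\phi]-\log\mathbb{E}_P[e^\phi]\}$; if $Q$ has finite first moment, this is finite, a maximizer $\phi^*\in\Gamma_L$ exists, unique on $\mathrm{supp}(Q)\cup\mathrm{supp}(P)$. $\phi^*$ is the first variation of $D^L_{\mathrm{KL}}(\cdot\|P)$ at $Q$; throughout, $\phi^*$ denotes a maximizer (as a function on $\mathbb{R}^d$) representing this first variation, meaning $\lim_{\epsilon\to0^{+}}\frac1\epsilon(D^L_{\mathrm{KL}}(Q+\epsilon\rho\|P)-D^L_{\mathrm{KL}}(Q\|P))=\int\phi^*\,d\rho$ for every right-admissible $\rho$ at $Q$, and likewise with $\epsilon\to0^-$ for every left-admissible $\rho$ at $Q$. VaR and CVaR. For $Q$ with $\mathbb{E}_Q[g]<\infty$, let $\Psi^{Q,g}(c)=Q(g\le c)$ and $\mathrm{VaR}_\alpha^{Q,g}:=\inf\{c\in\mathbb{R}:\Psi^{Q,g}(c)\ge\alpha\}$,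 $\overline{\mathrm{VaR}}_\alpha^{Q,g}:=\inf\{c\in\mathbb{R}:\Psi^{Q,g}(c)>\alpha\}$. CVaR is $\mathrm{CVaR}_\alpha^{Q,g}:=\beta\,\mathrm{VaR}_\alpha^{Q,g}+(1-\beta)\,\mathbb{E}_Q[g(X)\mid g(X)>\mathrm{VaR}_\alpha^{Q,g}]$ with $\beta=\frac{\Psi^{Q,g}(\mathrm{VaR}_\alpha^{Q,g})-\alpha}{1-\alpha}$ (second term read as $0$ if $\beta=1$). Known equivalent form (Rockafellar–Uryasev): $\mathrm{CVaR}_\alpha^{Q,g}=\inf_{y\in\mathbb{R}}\{y+\frac{1}{1-\alpha}\mathbb{E}_Q[(g-y)^+]\}$, and the set of minimizers is $T(Q)=[\mathrm{VaR}_\alpha^{Q,g},\overline{\mathrm{VaR}}_\alpha^{Q,g}]$. Admissible perturbations. A signed measure $\rho$ on $\mathbb{R}^d$ is right-admissible at $Q$ if $\int d\rho=0$, $\int d|\rho|<\infty$, $\int\|x\|\,d|\rho|<\infty$, and $Q+\epsilon\rho\in\mathcal{P}(\mathbb{R}^d)$ for all sufficiently small $\epsilon>0$. It is left-admissible at $Q$ if $-\rho$ is right-admissible at $Q$, and admissible at $Q$ if it is both right- and left-admissible at $Q$. Variational subgradients. For a functional $J$ that is locally Lipschitz with respect to $\mathcal{W}_1$ near $Q$, and $\rho$ admissible at $Q$, the Clarke generalized directional derivative is $J^\circ(Q;\rho):=\limsup_{Q'\to Q,\ t\downarrow0}\frac{J(Q'+t\rho)-J(Q')}{t}$, where $Q'\to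 Q$ in $\mathcal{W}_1$ and only pairs $(Q',t)$ with $Q',\,Q'+t\rho\in\mathcal{P}(\mathbb{R}^d)$ are considered. A function $\xi$ is a (first) variational subgradient of $J$ at $Q$ if $J^\circ(Q;\rho)\ge\int\xi\,d\rho$ for all $\rho$ admissible at $Q$. *)

theory Defs
  imports "HOL-Probability.Probability"
begin

section \<open>Borel probability measures, Wasserstein-1 distance, Lipschitz-regularized KL divergence\<close>

abbreviation borel_probs :: "'a::euclidean_space measure set" where
  "borel_probs \<equiv> space (prob_algebra borel)"

definition finite_first_moment :: "'a::euclidean_space measure \<Rightarrow> bool" where
  "finite_first_moment Q \<longleftrightarrow> integrable Q (\<lambda>x. norm x)"

definition couplings ::
  "'a::euclidean_space measure \<Rightarrow> 'a measure \<Rightarrow> ('a \<times> 'a) measure set" where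
  "couplings Q R = {\<pi> \<in> space (prob_algebra (borel \<Otimes>\<^sub>M borel)).
                      distr \<pi> borel fst = Q \<and> distr \<pi> borel snd = R}"

definition W1 :: "'a::euclidean_space measure \<Rightarrow> 'a measure \<Rightarrow> ennreal" where
  "W1 Q R = (INF \<pi>\<in>couplings Q R. \<integral>\<^sup>+ z. ennreal (dist (fst z) (snd z)) \<partial>\<pi>)"

(* The library's KL_divergence b M N is D(N || M) and is real valued (0 if the integral does not
   exist).  For probability measures the negative part of the log-density is always integrable
   and the divergence is nonnegative, so failure of integrability means an infinite divergence. *)
definition KL :: "'a::euclidean_space measure \<Rightarrow> 'a measure \<Rightarrow> ennreal" where
  "KL \<gamma> P = (if absolutely_continuous P \<gamma> \<and> integrable \<gamma> (entropy_density (exp 1) P \<gamma>)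
              then ennreal (KL_divergence (exp 1) P \<gamma>) else \<infinity>)"

definition DKL_Lip :: "real \<Rightarrow> 'a::euclidean_space measure \<Rightarrow> 'a measure \<Rightarrow> ennreal" where
  "DKL_Lip L Q P = (INF \<gamma>\<in>borel_probs. KL \<gamma> P + ennreal L * W1 Q \<gamma>)"

definition Gamma_Lip :: "real \<Rightarrow> ('a::euclidean_space \<Rightarrow> real) set" where
  "Gamma_Lip L = {\<phi>. L-lipschitz_on UNIV \<phi>}"

(* E_Q[phi] - log E_P[exp phi]; it is -infinity when E_P[exp phi] is infinite. *)
definition dual_objective ::
  "'a::euclidean_space measure \<Rightarrow> 'a measure \<Rightarrow> ('a \<Rightarrow> real) \<Rightarrow> ereal" where
  "dual_objective Q P \<phi> =
     (if integrable P (\<lambda>x. exp (\<phi> x))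
      then ereal ((\<integral>x. \<phi> x \<partial>Q) - ln (\<integral>x. exp (\<phi> x) \<partial>P)) else -\<infinity>)"

definition dual_maximizer ::
  "real \<Rightarrow> 'a::euclidean_space measure \<Rightarrow> 'a measure \<Rightarrow> ('a \<Rightarrow> real) \<Rightarrow> bool" where
  "dual_maximizer L Q P \<phi> \<longleftrightarrow>
     \<phi> \<in> Gamma_Lip L \<and> (\<forall>\<psi>\<in>Gamma_Lip L. dual_objective Q P \<psi> \<le> dual_objective Q P \<phi>)"


section \<open>VaR and CVaR\<close>

definition Psi :: "'a::euclidean_space measure \<Rightarrow> ('a \<Rightarrow> real) \<Rightarrow> real \<Rightarrow> real" where
  "Psi Q g c = measure Q {x. g x \<le> c}"

definition VaR :: "real \<Rightarrow> 'a::euclidean_space measure \<Rightarrow> ('a \<Rightarrow> real) \<Rightarrow> real" where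
  "VaR \<alpha> Q g = Inf {c. Psi Q g c \<ge> \<alpha>}"

definition VaR_upper :: "real \<Rightarrow> 'a::euclidean_space measure \<Rightarrow> ('a \<Rightarrow> real) \<Rightarrow> real" where
  "VaR_upper \<alpha> Q g = Inf {c. Psi Q g c > \<alpha>}"

definition CVaR_weight :: "real \<Rightarrow> 'a::euclidean_space measure \<Rightarrow> ('a \<Rightarrow> real) \<Rightarrow> real" where
  "CVaR_weight \<alpha> Q g = (Psi Q g (VaR \<alpha> Q g) - \<alpha>) / (1 - \<alpha>)"

definition cond_expect_above :: "'a::euclidean_space measure \<Rightarrow> ('a \<Rightarrow> real) \<Rightarrow> real \<Rightarrow> real" where
  "cond_expect_above Q g v = (LINT x:{x. g x > v}|Q. g x) / measure Q {x. g x > v}"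

(* If the weight is 1 the second summand is 0 because of its factor. *)
definition CVaR :: "real \<Rightarrow> 'a::euclidean_space measure \<Rightarrow> ('a \<Rightarrow> real) \<Rightarrow> real" where
  "CVaR \<alpha> Q g = CVaR_weight \<alpha> Q g * VaR \<alpha> Q g
                + (1 - CVaR_weight \<alpha> Q g) * cond_expect_above Q g (VaR \<alpha> Q g)"

definition T_set :: "real \<Rightarrow> 'a::euclidean_space measure \<Rightarrow> ('a \<Rightarrow> real) \<Rightarrow> real set" where
  "T_set \<alpha> Q g = {VaR \<alpha> Q g .. VaR_upper \<alpha> Q g}"


section \<open>Finite signed measures and admissible perturbations\<close>

(* A signed measure of finite total variation is a real-valued countably additive function on the
   Borel sets; its values on other sets are never used. *)
definition signed_measure :: "('a::euclidean_space set \<Rightarrow> real) \<Rightarrow> bool" where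
  "signed_measure \<rho> \<longleftrightarrow> \<rho> {} = 0 \<and>
     (\<forall>A :: nat \<Rightarrow> 'a set. range A \<subseteq> sets borel \<longrightarrow> disjoint_family A \<longrightarrow>
        (\<lambda>i. \<rho> (A i)) sums \<rho> (\<Union>i. A i))"

(* Jordan decomposition: upper variation, lower variation, and their sum |rho|. *)
definition upper_variation :: "('a::euclidean_space set \<Rightarrow> real) \<Rightarrow> 'a measure" where
  "upper_variation \<rho> = measure_of UNIV (sets borel)
     (\<lambda>A. SUP B\<in>{B \<in> sets borel. B \<subseteq> A}. ennreal (\<rho> B))"

definition lower_variation :: "('a::euclidean_space set \<Rightarrow> real) \<Rightarrow> 'a measure" where
  "lower_variation \<rho> = upper_variation (\<lambda>A. - \<rho> A)"

definition total_variation :: "('a::euclidean_space set \<Rightarrow> real) \<Rightarrow> 'a measure" where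
  "total_variation \<rho> = measure_of UNIV (sets borel)
     (\<lambda>A. emeasure (upper_variation \<rho>) A + emeasure (lower_variation \<rho>) A)"

definition signed_integral ::
  "('a::euclidean_space set \<Rightarrow> real) \<Rightarrow> ('a \<Rightarrow> real) \<Rightarrow> real" where
  "signed_integral \<rho> f = (\<integral>x. f x \<partial>upper_variation \<rho>) - (\<integral>x. f x \<partial>lower_variation \<rho>)"

definition perturb ::
  "'a::euclidean_space measure \<Rightarrow> real \<Rightarrow> ('a set \<Rightarrow> real) \<Rightarrow> 'a measure" where
  "perturb Q \<epsilon> \<rho> = measure_of UNIV (sets borel) (\<lambda>A. ennreal (measure Q A + \<epsilon> * \<rho> A))"

(* Q + eps rho is a probability measure.  Nonnegativity is stated separately since ennreal
   truncates negative values. *)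
definition perturb_prob ::
  "'a::euclidean_space measure \<Rightarrow> real \<Rightarrow> ('a set \<Rightarrow> real) \<Rightarrow> bool" where
  "perturb_prob Q \<epsilon> \<rho> \<longleftrightarrow>
     (\<forall>A\<in>sets borel. 0 \<le> measure Q A + \<epsilon> * \<rho> A) \<and> perturb Q \<epsilon> \<rho> \<in> borel_probs"

definition right_admissible ::
  "'a::euclidean_space measure \<Rightarrow> ('a set \<Rightarrow> real) \<Rightarrow> bool" where
  "right_admissible Q \<rho> \<longleftrightarrow> signed_measure \<rho> \<and> \<rho> UNIV = 0 \<and>
     emeasure (total_variation \<rho>) UNIV < \<infinity> \<and>
     (\<integral>\<^sup>+ x. ennreal (norm x) \<partial>total_variation \<rho>) < \<infinity> \<and>
     (\<forall>\<^sub>F \<epsilon> in at_right 0. perturb_prob Q \<epsilon> \<rho>)"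

definition left_admissible ::
  "'a::euclidean_space measure \<Rightarrow> ('a set \<Rightarrow> real) \<Rightarrow> bool" where
  "left_admissible Q \<rho> \<longleftrightarrow> right_admissible Q (\<lambda>A. - \<rho> A)"

definition admissible ::
  "'a::euclidean_space measure \<Rightarrow> ('a set \<Rightarrow> real) \<Rightarrow> bool" where
  "admissible Q \<rho> \<longleftrightarrow> right_admissible Q \<rho> \<and> left_admissible Q \<rho>"


section \<open>Directional derivatives and variational subgradients\<close>

definition diff_quotient ::
  "('a::euclidean_space measure \<Rightarrow> real) \<Rightarrow> 'a measure \<Rightarrow> ('a set \<Rightarrow> real) \<Rightarrow> real \<Rightarrow> real" where
  "diff_quotient J Q \<rho> \<epsilon> = (J (perturb Q \<epsilon> \<rho>) - J Q) / \<epsilon>"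

definition has_right_derivative ::
  "('a::euclidean_space measure \<Rightarrow> real) \<Rightarrow> 'a measure \<Rightarrow> ('a set \<Rightarrow> real) \<Rightarrow> real \<Rightarrow> bool" where
  "has_right_derivative J Q \<rho> D \<longleftrightarrow> (diff_quotient J Q \<rho> \<longlongrightarrow> D) (at_right 0)"

definition has_left_derivative ::
  "('a::euclidean_space measure \<Rightarrow> real) \<Rightarrow> 'a measure \<Rightarrow> ('a set \<Rightarrow> real) \<Rightarrow> real \<Rightarrow> bool" where
  "has_left_derivative J Q \<rho> D \<longleftrightarrow> (diff_quotient J Q \<rho> \<longlongrightarrow> D) (at_left 0)"

definition has_gateaux_derivative ::
  "('a::euclidean_space measure \<Rightarrow> real) \<Rightarrow> 'a measure \<Rightarrow> ('a set \<Rightarrow> real) \<Rightarrow> real \<Rightarrow> bool" where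
  "has_gateaux_derivative J Q \<rho> D \<longleftrightarrow> (diff_quotient J Q \<rho> \<longlongrightarrow> D) (at 0)"

definition right_derivative ::
  "('a::euclidean_space measure \<Rightarrow> real) \<Rightarrow> 'a measure \<Rightarrow> ('a set \<Rightarrow> real) \<Rightarrow> real" where
  "right_derivative J Q \<rho> = Lim (at_right 0) (diff_quotient J Q \<rho>)"

definition left_derivative ::
  "('a::euclidean_space measure \<Rightarrow> real) \<Rightarrow> 'a measure \<Rightarrow> ('a set \<Rightarrow> real) \<Rightarrow> real" where
  "left_derivative J Q \<rho> = Lim (at_left 0) (diff_quotient J Q \<rho>)"

definition first_variation ::
  "('a::euclidean_space measure \<Rightarrow> real) \<Rightarrow> 'a measure \<Rightarrow> ('a \<Rightarrow> real) \<Rightarrow> bool" where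
  "first_variation J Q \<phi> \<longleftrightarrow>
     (\<forall>\<rho>. right_admissible Q \<rho> \<longrightarrow> has_right_derivative J Q \<rho> (signed_integral \<rho> \<phi>)) \<and>
     (\<forall>\<rho>. left_admissible Q \<rho> \<longrightarrow> has_left_derivative J Q \<rho> (signed_integral \<rho> \<phi>))"

definition locally_Lipschitz_W1 ::
  "('a::euclidean_space measure \<Rightarrow> real) \<Rightarrow> 'a measure \<Rightarrow> bool" where
  "locally_Lipschitz_W1 J Q \<longleftrightarrow>
     (\<exists>r>0. \<exists>K\<ge>0. \<forall>Q1\<in>borel_probs. \<forall>Q2\<in>borel_probs.
        W1 Q1 Q < ennreal r \<longrightarrow> W1 Q2 Q < ennreal r \<longrightarrow>
        ennreal \<bar>J Q1 - J Q2\<bar> \<le> ennreal K * W1 Q1 Q2)"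

(* The limsup as Q' -> Q in W1 and t -> 0+, written out as inf over r of the sup over pairs
   (Q', t) with W1(Q', Q) < r and 0 < t < r. *)
definition clarke_derivative ::
  "('a::euclidean_space measure \<Rightarrow> real) \<Rightarrow> 'a measure \<Rightarrow> ('a set \<Rightarrow> real) \<Rightarrow> ereal" where
  "clarke_derivative J Q \<rho> =
     (INF r\<in>{0<..}.
        SUP (Q', t)\<in>{(Q', t). Q' \<in> borel_probs \<and> perturb_prob Q' t \<rho> \<and>
                              W1 Q' Q < ennreal r \<and> 0 < t \<and> t < r}.
          ereal ((J (perturb Q' t \<rho>) - J Q') / t))"

(* The notion is defined only for functionals that are locally Lipschitz near Q, so this is part
   of the predicate. *)
definition variational_subgradient ::
  "('a::euclidean_space measure \<Rightarrow> real) \<Rightarrow> 'a measure \<Rightarrow> ('a \<Rightarrow> real) \<Rightarrow> bool" where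
  "variational_subgradient J Q \<xi> \<longleftrightarrow> locally_Lipschitz_W1 J Q \<and>
     (\<forall>\<rho>. admissible Q \<rho> \<longrightarrow> ereal (signed_integral \<rho> \<xi>) \<le> clarke_derivative J Q \<rho>)"


section \<open>The CVaR-penalized functional\<close>

(* DKL_Lip L Q P is finite whenever Q has finite first moment, hence at every measure of finite
   W1 distance to such a Q; enn2real is only a coercion there. *)
definition DKL_Lip_real :: "real \<Rightarrow> 'a::euclidean_space measure \<Rightarrow> 'a measure \<Rightarrow> real" where
  "DKL_Lip_real L P Q = enn2real (DKL_Lip L Q P)"

definition Delta_C ::
  "real \<Rightarrow> ('a::euclidean_space \<Rightarrow> real) \<Rightarrow> 'a measure \<Rightarrow> 'a measure \<Rightarrow> real" where
  "Delta_C \<alpha> g P Q = CVaR \<alpha> P g - CVaR \<alpha> Q g"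

definition F_CVaR ::
  "real \<Rightarrow> real \<Rightarrow> real \<Rightarrow> ('a::euclidean_space \<Rightarrow> real) \<Rightarrow> 'a measure \<Rightarrow> 'a measure \<Rightarrow> real" where
  "F_CVaR L lam \<alpha> g P Q = DKL_Lip_real L P Q + lam * (Delta_C \<alpha> g P Q)\<^sup>2"

definition h_fun :: "real \<Rightarrow> ('a::euclidean_space \<Rightarrow> real) \<Rightarrow> real \<Rightarrow> 'a \<Rightarrow> real" where
  "h_fun \<alpha> g y x = max 0 (g x - y) / (1 - \<alpha>)"

definition Phi_fun ::
  "real \<Rightarrow> real \<Rightarrow> ('a::euclidean_space \<Rightarrow> real) \<Rightarrow> 'a measure \<Rightarrow> 'a measure \<Rightarrow>
   ('a \<Rightarrow> real) \<Rightarrow> real \<Rightarrow> 'a \<Rightarrow> real" where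
  "Phi_fun lam \<alpha> g P Q \<phi> y x = \<phi> x - 2 * lam * Delta_C \<alpha> g P Q * h_fun \<alpha> g y x"

end

theory Submission
  imports Defs
begin

text \<open>By Rockafellar--Uryasev, CVaR is the minimum over \<open>y\<close> of \<open>y + E\<^sub>Q[h\<^sup>y]\<close>, attained exactly on \<open>T(Q)\<close>.
  Along \<open>Q + \<epsilon> \<rho>\<close> this objective is affine in \<open>\<epsilon>\<close>, so an envelope (Danskin) argument gives the one-sided
  derivatives of CVaR as the minimum and maximum of \<open>\<integral> h\<^sup>y d\<rho>\<close> over \<open>T(Q)\<close>; the chain rule for the
  square and the first variation of the divergence do the rest. Both terms are Lipschitz for \<open>W\<^sub>1\<close>, and the
  Clarke derivative dominates both one-sided derivatives: take \<open>Q' = Q\<close> for the right one and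
  \<open>Q' = Q - t \<rho>\<close> for the left one.\<close>

section \<open>Measures, signed measures and perturbations\<close>

text \<open>The variable y in the Rockafellar-Uryasev formula ranges over the whole line, so
  minimizers of a perturbed objective have to be confined near T(Q) without compactness. Linear
  growth of the objective off T(Q) does this: the integral of \<open>h^y\<close> against \<rho> is
  Lipschitz in y, hence dominated by the growth once it is multiplied by a small \<epsilon>. A
  signed measure is only a set function, whereas integrals refer to its Jordan parts. The Hahn set
  is taken from the two probability measures Q and Q + \<epsilon> \<rho>, and comparisons are kept
  between nonnegative combinations of measures, so that nothing infinite is subtracted. The sign of
  the CVaR gap decides which one-sided derivative is larger; this is why the range of values is an
  unoriented segment. If the gap is nonzero and T(Q) is not a point, some admissible direction must
  destroy differentiability; it is Q conditioned on {g \<le> VaR}, minus Q. Local Lipschitz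
  continuity of the divergence rests on the triangle inequality for W1, which needs a gluing of
  couplings.\<close>

text \<open>Both sides are additive, homogeneous and continuous along increasing sequences in f, so
  the inequality on sets passes to functions. Two slots on each side cover domination as well as the
  subtraction-free identity Q + \<epsilon> \<rho> plus \<epsilon> times the lower variation equals Q
  plus \<epsilon> times the upper one; a coefficient 0 empties a slot.\<close>

lemma nn_integral_comb_mono:
  fixes a1 a2 a3 a4 :: ennreal
  assumes [measurable_cong]: "sets M1 = sets M" "sets M2 = sets M" "sets M3 = sets M" "sets M4 = sets M"
    and le: "\<And>A. A \<in> sets M \<Longrightarrow>
      a1 * emeasure M1 A + a2 * emeasure M2 A \<le> a3 * emeasure M3 A + a4 * emeasure M4 A"
    and f: "f \<in> borel_measurable M"
  shows "a1 * integral\<^sup>N M1 f + a2 * integral\<^sup>N M2 f \<le> a3 * integral\<^sup>N M3 f + a4 * integral\<^sup>N M4 f"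
  using f
proof (induction rule: borel_measurable_induct)
  case (cong f g)
  have sp: "space M1 = space M" "space M2 = space M" "space M3 = space M" "space M4 = space M"
    using assms(1-4) by (auto dest: sets_eq_imp_space_eq)
  have "integral\<^sup>N M1 f = integral\<^sup>N M1 g" "integral\<^sup>N M2 f = integral\<^sup>N M2 g"
    "integral\<^sup>N M3 f = integral\<^sup>N M3 g" "integral\<^sup>N M4 f = integral\<^sup>N M4 g"
    using cong(3) by (auto intro!: nn_integral_cong simp: sp)
  with cong show ?case by simp
next
  case (set A)
  with le[OF this] show ?case by (simp add: assms(1-4))
next
  case (mult u c)
  note [measurable] = mult(2)
  have "c * (a1 * integral\<^sup>N M1 u + a2 * integral\<^sup>N M2 u) \<le> c * (a3 * integral\<^sup>N M3 u + a4 * integral\<^sup>N M4 u)"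
    by (intro mult_left_mono mult.IH) auto
  then show ?case
    by (simp add: nn_integral_cmult distrib_left mult.left_commute)
next
  case (add u v)
  have [measurable]: "u \<in> borel_measurable M" "v \<in> borel_measurable M" by fact+
  show ?case
    using add_mono[OF add.IH(1) add.IH(2)]
    by (simp add: nn_integral_add distrib_left ac_simps)
next
  case (seq U)
  note [measurable] = seq(1)
  have S: "integral\<^sup>N N (Sup (range U)) = (SUP i. integral\<^sup>N N (U i))" if [measurable_cong]: "sets N = sets M" for N
    unfolding SUP_apply[abs_def]
    by (rule nn_integral_monotone_convergence_SUP) (use seq(3) in auto)
  have inc: "incseq (\<lambda>i. a * integral\<^sup>N N (U i))" for N and a :: ennreal
    using seq(3) by (auto simp: incseq_def le_fun_def intro!: mult_left_mono nn_integral_mono)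
  have "a1 * integral\<^sup>N M1 (Sup (range U)) + a2 * integral\<^sup>N M2 (Sup (range U))
      = (SUP i. a1 * integral\<^sup>N M1 (U i) + a2 * integral\<^sup>N M2 (U i))"
    by (simp add: S assms(1-4) SUP_mult_left_ennreal ennreal_SUP_add[OF inc inc])
  also have "\<dots> \<le> (SUP i. a3 * integral\<^sup>N M3 (U i) + a4 * integral\<^sup>N M4 (U i))"
    by (intro SUP_mono) (use seq.IH in auto)
  also have "\<dots> = a3 * integral\<^sup>N M3 (Sup (range U)) + a4 * integral\<^sup>N M4 (Sup (range U))"
    by (simp add: S assms(1-4) SUP_mult_left_ennreal ennreal_SUP_add[OF inc inc])
  finally show ?case .
qed

lemma nn_integral_comb_eq:
  fixes a1 a2 a3 a4 :: ennreal
  assumes "sets M1 = sets M" "sets M2 = sets M" "sets M3 = sets M" "sets M4 = sets M"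
    and eq: "\<And>A. A \<in> sets M \<Longrightarrow>
      a1 * emeasure M1 A + a2 * emeasure M2 A = a3 * emeasure M3 A + a4 * emeasure M4 A"
    and f: "f \<in> borel_measurable M"
  shows "a1 * integral\<^sup>N M1 f + a2 * integral\<^sup>N M2 f = a3 * integral\<^sup>N M3 f + a4 * integral\<^sup>N M4 f"
  by (intro antisym nn_integral_comb_mono[OF _ _ _ _ _ f]) (simp_all add: assms)

text \<open>Since \<open>ennreal\<close> truncates at 0, applying the nonnegative version to f and
  to -f treats the positive and the negative part separately; integrability makes all four values
  finite, which permits the final subtraction.\<close>

lemma integral_comb_eq:
  fixes f :: "'a \<Rightarrow> real" and a2 a4 :: real
  assumes S: "sets M1 = sets M" "sets M2 = sets M" "sets M3 = sets M" "sets M4 = sets M"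
    and eq: "\<And>A. A \<in> sets M \<Longrightarrow>
      emeasure M1 A + ennreal a2 * emeasure M2 A = emeasure M3 A + ennreal a4 * emeasure M4 A"
    and pos: "0 \<le> a2" "0 \<le> a4"
    and I: "integrable M1 f" "integrable M2 f" "integrable M3 f" "integrable M4 f"
  shows "integral\<^sup>L M1 f + a2 * integral\<^sup>L M2 f = integral\<^sup>L M3 f + a4 * integral\<^sup>L M4 f"
proof -
  have f[measurable]: "f \<in> borel_measurable M"
    using I(1) S(1) borel_measurable_integrable measurable_cong_sets by blast
  have fin: "integral\<^sup>N N (\<lambda>x. ennreal (h x)) = ennreal (enn2real (integral\<^sup>N N (\<lambda>x. ennreal (h x))))"
    if "integrable N h" for N and h :: "'a \<Rightarrow> real"
    using that by (simp add: real_integrable_def less_top)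
  have *: "enn2real (\<integral>\<^sup>+x. ennreal (h x) \<partial>M1) + a2 * enn2real (\<integral>\<^sup>+x. ennreal (h x) \<partial>M2)
      = enn2real (\<integral>\<^sup>+x. ennreal (h x) \<partial>M3) + a4 * enn2real (\<integral>\<^sup>+x. ennreal (h x) \<partial>M4)"
    if h: "integrable M1 h" "integrable M2 h" "integrable M3 h" "integrable M4 h" for h :: "'a \<Rightarrow> real"
  proof -
    have [measurable]: "h \<in> borel_measurable M"
      using h(1) S(1) borel_measurable_integrable measurable_cong_sets by blast
    have "1 * (\<integral>\<^sup>+x. ennreal (h x) \<partial>M1) + ennreal a2 * (\<integral>\<^sup>+x. ennreal (h x) \<partial>M2)
      = 1 * (\<integral>\<^sup>+x. ennreal (h x) \<partial>M3) + ennreal a4 * (\<integral>\<^sup>+x. ennreal (h x) \<partial>M4)"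
      by (rule nn_integral_comb_eq[OF S]) (simp_all add: eq)
    then have "ennreal (enn2real (\<integral>\<^sup>+x. ennreal (h x) \<partial>M1) + a2 * enn2real (\<integral>\<^sup>+x. ennreal (h x) \<partial>M2))
      = ennreal (enn2real (\<integral>\<^sup>+x. ennreal (h x) \<partial>M3) + a4 * enn2real (\<integral>\<^sup>+x. ennreal (h x) \<partial>M4))"
      using pos by (simp add: ennreal_mult fin[OF h(1), symmetric] fin[OF h(2), symmetric] 
        fin[OF h(3), symmetric] fin[OF h(4), symmetric])
    then show ?thesis
      using pos by (subst (asm) ennreal_inj) auto
  qed
  show ?thesis
    using *[of f] *[of "\<lambda>x. - f x"] I
    by (simp add: real_lebesgue_integral_def algebra_simps)
qed

section \<open>Signed measures and perturbed measures\<close>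

lemma borel_probs_iff: "R \<in> borel_probs \<longleftrightarrow> sets R = sets borel \<and> prob_space R"
  by (simp add: space_prob_algebra)

lemma signed_measure_uminus: "signed_measure \<rho> \<Longrightarrow> signed_measure (\<lambda>A. - \<rho> A)"
  unfolding signed_measure_def by (auto intro: sums_minus)

lemma signed_measure_sums:
  "signed_measure \<rho> \<Longrightarrow> range A \<subseteq> sets borel \<Longrightarrow> disjoint_family A \<Longrightarrow> (\<lambda>i. \<rho> (A i)) sums \<rho> (\<Union>i. A i)"
  by (simp add: signed_measure_def)

lemma signed_measure_Un:
  assumes "signed_measure \<rho>" "A \<in> sets borel" "B \<in> sets borel" "A \<inter> B = {}"
  shows "\<rho> (A \<union> B) = \<rho> A + \<rho> B"
proof -
  have "(\<lambda>i. \<rho> (binaryset A B i)) sums \<rho> (\<Union>i. binaryset A B i)"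
    using assms unfolding signed_measure_def
    by (elim conjE allE[of _ "binaryset A B"]) (auto simp: range_binaryset_eq disjoint_family_on_def binaryset_def split: if_splits)
  then show ?thesis
    using binaryset_sums[of \<rho> A B] assms(1) by (auto simp: UN_binaryset_eq signed_measure_def dest: sums_unique2)
qed

text \<open>\<open>measure_of\<close> returns the given function only if that is countably additive,
  and 0 otherwise. Here F is the formula in a definition (a supremum, a sum, a truncation), and
  \<mu> is the real function to which it reduces on Borel sets and whose additivity is easy to
  check.\<close>

lemma emeasure_measure_of_sums:
  fixes \<mu> :: "'a::euclidean_space set \<Rightarrow> real"
  assumes "\<And>A. A \<in> sets borel \<Longrightarrow> 0 \<le> \<mu> A" "\<mu> {} = 0"
    and sums: "\<And>A::nat \<Rightarrow> 'a set. range A \<subseteq> sets borel \<Longrightarrow> disjoint_family A \<Longrightarrow> (\<lambda>i. \<mu> (A i)) sums \<mu> (\<Union>i. A i)"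
    and F: "\<And>A. A \<in> sets borel \<Longrightarrow> F A = ennreal (\<mu> A)" and A: "A \<in> sets borel"
  shows "emeasure (measure_of UNIV (sets borel) F) A = ennreal (\<mu> A)"
proof (subst F[OF A, symmetric], rule emeasure_measure_of_sigma)
  show "sigma_algebra UNIV (sets (borel :: 'a measure))"
    by (metis sets.sigma_algebra_axioms space_borel)
  show "positive (sets borel) F" using assms(2) by (simp add: positive_def F)
  show "countably_additive (sets borel) F"
  proof (rule countably_additiveI)
    fix A :: "nat \<Rightarrow> 'a set"
    assume *: "range A \<subseteq> sets borel" "disjoint_family A" "(\<Union>i. A i) \<in> sets borel"
    have "(\<lambda>i. ennreal (\<mu> (A i))) sums ennreal (\<mu> (\<Union>i. A i))"
      using sums[OF *(1,2)] *(1) assms(1) by (subst sums_ennreal) (auto intro!: *(3))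
    then show "(\<Sum>i. F (A i)) = F (\<Union>i. A i)"
      using * by (simp add: F sums_iff image_subset_iff)
  qed
qed (fact A)

lemma sets_upper_variation [simp, measurable_cong]: "sets (upper_variation \<rho>) = sets borel"
  and sets_lower_variation [simp, measurable_cong]: "sets (lower_variation \<rho>) = sets borel"
  and sets_total_variation [simp, measurable_cong]: "sets (total_variation \<rho>) = sets borel"
  and sets_perturb [simp, measurable_cong]: "sets (perturb Q \<epsilon> \<rho>) = sets borel"
proof -
  have "sigma_sets UNIV (sets (borel::'a measure)) = sets borel"
    by (metis sets.sigma_sets_eq space_borel)
  then show "sets (upper_variation \<rho>) = sets borel" "sets (lower_variation \<rho>) = sets borel"
    "sets (total_variation \<rho>) = sets borel" "sets (perturb Q \<epsilon> \<rho>) = sets borel"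
    unfolding lower_variation_def upper_variation_def total_variation_def perturb_def by simp_all
qed

section \<open>Jordan decomposition and integrals against a perturbation\<close>

text \<open>For B inside A, dropping the part of B off Y and adding the rest of A \<inter> Y can
  only increase \<rho>, so the supremum in \<open>upper_variation\<close> is attained at A \<inter>
  Y.\<close>

lemma upper_variation_Hahn:
  fixes \<rho> :: "'a::euclidean_space set \<Rightarrow> real"
  assumes \<rho>: "signed_measure \<rho>" and Y[measurable]: "Y \<in> sets borel"
    and pos: "\<And>A. A \<in> sets borel \<Longrightarrow> A \<subseteq> Y \<Longrightarrow> 0 \<le> \<rho> A"
    and neg: "\<And>A. A \<in> sets borel \<Longrightarrow> A \<inter> Y = {} \<Longrightarrow> \<rho> A \<le> 0"
    and A[measurable]: "A \<in> sets borel"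
  shows "emeasure (upper_variation \<rho>) A = ennreal (\<rho> (A \<inter> Y))"
  unfolding upper_variation_def
proof (rule emeasure_measure_of_sums[where \<mu>="\<lambda>A. \<rho> (A \<inter> Y)"])
  fix A :: "nat \<Rightarrow> 'a set" assume *: "range A \<subseteq> sets borel" "disjoint_family A"
  have "range (\<lambda>i. A i \<inter> Y) \<subseteq> sets borel" "disjoint_family (\<lambda>i. A i \<inter> Y)"
    using * by (auto simp: disjoint_family_on_def)
  then have "(\<lambda>i. \<rho> (A i \<inter> Y)) sums \<rho> (\<Union>i. A i \<inter> Y)"
    by (rule signed_measure_sums[OF \<rho>])
  then show "(\<lambda>i. \<rho> (A i \<inter> Y)) sums \<rho> ((\<Union>i. A i) \<inter> Y)" by simp
next
  fix A :: "'a set" assume A[measurable]: "A \<in> sets borel"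
  show "(SUP B\<in>{B \<in> sets borel. B \<subseteq> A}. ennreal (\<rho> B)) = ennreal (\<rho> (A \<inter> Y))"
  proof (intro antisym SUP_least)
    fix B assume B: "B \<in> {B \<in> sets borel. B \<subseteq> A}"
    then have [measurable]: "B \<in> sets borel" by simp
    have "\<rho> B = \<rho> (B \<inter> Y) + \<rho> (B - Y)"
      by (subst signed_measure_Un[OF \<rho>, symmetric]) (auto simp: Int_Diff_Un)
    moreover have "\<rho> (A \<inter> Y) = \<rho> (B \<inter> Y) + \<rho> ((A - B) \<inter> Y)"
      using B by (subst signed_measure_Un[OF \<rho>, symmetric]) (auto intro!: arg_cong[where f=\<rho>])
    moreover have "\<rho> (B - Y) \<le> 0" "0 \<le> \<rho> ((A - B) \<inter> Y)"
      by (auto intro!: neg pos)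
    ultimately show "ennreal (\<rho> B) \<le> ennreal (\<rho> (A \<inter> Y))" by (intro ennreal_leI) simp
  qed (auto intro!: SUP_upper)
qed (use \<rho> in \<open>auto intro!: pos simp: signed_measure_def\<close>)

lemma emeasure_perturb:
  fixes Q :: "'a::euclidean_space measure"
  assumes Q: "Q \<in> borel_probs" and \<rho>: "signed_measure \<rho>"
    and pos: "\<And>A. A \<in> sets borel \<Longrightarrow> 0 \<le> measure Q A + \<epsilon> * \<rho> A" and A: "A \<in> sets borel"
  shows "emeasure (perturb Q \<epsilon> \<rho>) A = ennreal (measure Q A + \<epsilon> * \<rho> A)"
  unfolding perturb_def
proof (rule emeasure_measure_of_sums)
  fix A :: "nat \<Rightarrow> 'a set" assume *: "range A \<subseteq> sets borel" "disjoint_family A"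
  interpret prob_space Q using Q by (simp add: borel_probs_iff)
  have "(\<lambda>i. measure Q (A i)) sums measure Q (\<Union>i. A i)"
    using Q * by (intro finite_measure_UNION) (auto simp: borel_probs_iff)
  moreover have "(\<lambda>i. \<epsilon> * \<rho> (A i)) sums (\<epsilon> * \<rho> (\<Union>i. A i))"
    using \<rho> * by (intro sums_mult) (auto simp: signed_measure_def)
  ultimately show "(\<lambda>i. measure Q (A i) + \<epsilon> * \<rho> (A i)) sums (measure Q (\<Union>i. A i) + \<epsilon> * \<rho> (\<Union>i. A i))"
    by (rule sums_add)
qed (use \<rho> in \<open>auto simp: pos A signed_measure_def\<close>)

lemma perturb_probI:
  fixes Q :: "'a::euclidean_space measure"
  assumes Q: "Q \<in> borel_probs" and \<rho>: "signed_measure \<rho>" "\<rho> UNIV = 0"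
    and pos: "\<And>A. A \<in> sets borel \<Longrightarrow> 0 \<le> measure Q A + \<epsilon> * \<rho> A"
  shows "perturb_prob Q \<epsilon> \<rho>"
proof -
  interpret prob_space Q using Q by (simp add: borel_probs_iff)
  have "space Q = UNIV" using Q by (auto simp: borel_probs_iff dest: sets_eq_imp_space_eq)
  moreover have "space (perturb Q \<epsilon> \<rho>) = UNIV" using sets_eq_imp_space_eq[OF sets_perturb, of Q \<epsilon> \<rho>] by simp
  ultimately have "prob_space (perturb Q \<epsilon> \<rho>)"
    by (intro prob_spaceI) (use \<rho>(2) prob_space in \<open>simp add: emeasure_perturb[OF Q \<rho>(1) pos]\<close>)
  then show ?thesis using pos by (simp add: perturb_prob_def borel_probs_iff)
qed

lemma measure_perturb:
  assumes "Q \<in> borel_probs" "signed_measure \<rho>" "perturb_prob Q \<epsilon> \<rho>" "A \<in> sets borel"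
  shows "measure (perturb Q \<epsilon> \<rho>) A = measure Q A + \<epsilon> * \<rho> A"
  using emeasure_perturb[OF assms(1,2) _ assms(4), of \<epsilon>] assms(3,4)
  by (auto simp: perturb_prob_def measure_def)

lemma perturb_uminus: "perturb Q \<epsilon> (\<lambda>A. - \<rho> A) = perturb Q (- \<epsilon>) \<rho>"
  by (simp add: perturb_def)

lemma perturb_prob_uminus: "perturb_prob Q \<epsilon> (\<lambda>A. - \<rho> A) \<longleftrightarrow> perturb_prob Q (- \<epsilon>) \<rho>"
  by (simp add: perturb_prob_def perturb_uminus)

lemma signed_integral_uminus: "signed_integral (\<lambda>A. - \<rho> A) f = - signed_integral \<rho> f"
  by (simp add: signed_integral_def lower_variation_def)

text \<open>The two probability measures Q and Q + \<epsilon> \<rho> differ by \<epsilon> \<rho>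
  with \<epsilon> > 0, so the Hahn set that separates where one or the other is larger also
  separates the signs of \<rho>.\<close>

lemma Hahn_decomposition_perturb:
  fixes Q :: "'a::euclidean_space measure"
  assumes Q: "Q \<in> borel_probs" and \<rho>: "signed_measure \<rho>" and p: "perturb_prob Q \<epsilon> \<rho>" and \<epsilon>: "0 < \<epsilon>"
  obtains Y where "Y \<in> sets borel" "\<And>A. A \<in> sets borel \<Longrightarrow> A \<subseteq> Y \<Longrightarrow> 0 \<le> \<rho> A"
    "\<And>A. A \<in> sets borel \<Longrightarrow> A \<inter> Y = {} \<Longrightarrow> \<rho> A \<le> 0"
proof -
  let ?R = "perturb Q \<epsilon> \<rho>"
  have sQ: "sets Q = sets borel" and "prob_space Q" using Q by (auto simp: borel_probs_iff)
  have "prob_space ?R" using p by (auto simp: perturb_prob_def borel_probs_iff)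
  interpret Q: prob_space Q by fact
  interpret R: prob_space ?R by fact
  have "\<exists>Y\<in>sets ?R. (\<forall>X\<in>sets ?R. X \<subseteq> Y \<longrightarrow> Q X \<le> ?R X) \<and> (\<forall>X\<in>sets ?R. X \<inter> Y = {} \<longrightarrow> ?R X \<le> Q X)"
    by (rule finite_unsigned_Hahn_decomposition) (simp_all add: sQ Q.finite_measure_axioms R.finite_measure_axioms)
  then obtain Y where Y: "Y \<in> sets borel" "\<And>X. X \<in> sets borel \<Longrightarrow> X \<subseteq> Y \<Longrightarrow> Q X \<le> ?R X"
    "\<And>X. X \<in> sets borel \<Longrightarrow> X \<inter> Y = {} \<Longrightarrow> ?R X \<le> Q X"
    by auto
  show thesis
  proof (rule that[OF Y(1)])
    fix A :: "'a set" assume A: "A \<in> sets borel"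
    note m = Q.emeasure_eq_measure R.emeasure_eq_measure measure_perturb[OF Q \<rho> p A]
    show "0 \<le> \<rho> A" if "A \<subseteq> Y"
      using Y(2)[OF A that] \<epsilon> measure_nonneg[of Q A] measure_nonneg[of ?R A]
      by (simp add: m zero_le_mult_iff)
    show "\<rho> A \<le> 0" if "A \<inter> Y = {}"
      using Y(3)[OF A that] \<epsilon> by (simp add: m mult_le_0_iff)
  qed
qed

text \<open>On a Hahn set Y the variations become \<rho>(A \<inter> Y) and -\<rho>(A - Y), and
  everything is real arithmetic. The two bounds serve to carry integrability from Q and Q +
  \<epsilon> \<rho> over to the Jordan parts.\<close>

lemma
  fixes Q :: "'a::euclidean_space measure"
  assumes Q: "Q \<in> borel_probs" and \<rho>: "signed_measure \<rho>" and p: "perturb_prob Q \<epsilon> \<rho>" and \<epsilon>: "0 < \<epsilon>"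
    and A[measurable]: "A \<in> sets borel"
  shows emeasure_perturb_Jordan:
      "emeasure (perturb Q \<epsilon> \<rho>) A + ennreal \<epsilon> * emeasure (lower_variation \<rho>) A
         = emeasure Q A + ennreal \<epsilon> * emeasure (upper_variation \<rho>) A" (is ?eq)
    and upper_variation_le: "ennreal \<epsilon> * emeasure (upper_variation \<rho>) A \<le> emeasure (perturb Q \<epsilon> \<rho>) A" (is ?up)
    and lower_variation_le: "ennreal \<epsilon> * emeasure (lower_variation \<rho>) A \<le> emeasure Q A" (is ?lo)
    and emeasure_total_variation: "emeasure (total_variation \<rho>) A
         = emeasure (upper_variation \<rho>) A + emeasure (lower_variation \<rho>) A" (is ?tv)
proof -
  obtain Y where Y[measurable]: "Y \<in> sets borel"
    and pos: "\<And>A. A \<in> sets borel \<Longrightarrow> A \<subseteq> Y \<Longrightarrow> 0 \<le> \<rho> A"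
    and neg: "\<And>A. A \<in> sets borel \<Longrightarrow> A \<inter> Y = {} \<Longrightarrow> \<rho> A \<le> 0"
    using Hahn_decomposition_perturb[OF Q \<rho> p \<epsilon>] by metis
  have U: "emeasure (upper_variation \<rho>) A = ennreal (\<rho> (A \<inter> Y))" if "A \<in> sets borel" for A
    by (rule upper_variation_Hahn[OF \<rho> Y pos neg that])
  have L: "emeasure (lower_variation \<rho>) A = ennreal (- \<rho> (A - Y))" if A: "A \<in> sets borel" for A
    unfolding lower_variation_def Diff_eq
    by (rule upper_variation_Hahn[OF signed_measure_uminus[OF \<rho>] _ _ _ A]) (auto intro: neg pos)
  have dec: "\<rho> A = \<rho> (A \<inter> Y) + \<rho> (A - Y)" if [measurable]: "A \<in> sets borel" for A
    by (subst signed_measure_Un[OF \<rho>, symmetric]) (auto simp: Int_Diff_Un)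
  have sg: "0 \<le> \<rho> (A \<inter> Y)" "\<rho> (A - Y) \<le> 0" if [measurable]: "A \<in> sets borel" for A
    by (auto intro!: pos neg)
  have "prob_space Q" using Q by (auto simp: borel_probs_iff)
  interpret prob_space Q by fact
  have E: "emeasure (perturb Q \<epsilon> \<rho>) A = ennreal (measure Q A + \<epsilon> * \<rho> A)" and nn: "0 \<le> measure Q A + \<epsilon> * \<rho> A"
    if "A \<in> sets borel" for A
    using emeasure_perturb[OF Q \<rho> _ that] p that by (auto simp: perturb_prob_def)
  show ?eq
    using sg[OF A] nn[OF A] \<epsilon> mult_nonneg_nonpos[of \<epsilon> "\<rho> (A - Y)"]
    by (simp add: E U L emeasure_eq_measure ennreal_plus[symmetric] ennreal_mult[symmetric] dec[OF A]
        distrib_left del: ennreal_plus)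
  \<comment> \<open>Nonnegativity of Q + \<epsilon> \<rho> on A - Y and monotonicity of Q give this
    bound and the one for the lower variation.\<close>
  have "\<epsilon> * \<rho> (A \<inter> Y) \<le> measure Q A + \<epsilon> * \<rho> A"
  proof -
    have "0 \<le> measure Q (A - Y) + \<epsilon> * \<rho> (A - Y)" by (rule nn) simp
    also have "measure Q (A - Y) \<le> measure Q A"
      using Q A by (intro finite_measure_mono) (auto simp: borel_probs_iff)
    finally show ?thesis using dec[OF A] by (simp add: distrib_left)
  qed
  then show ?up
    using \<epsilon> sg[OF A] by (simp add: E U ennreal_mult[symmetric] ennreal_leI)
  have "\<epsilon> * - \<rho> (A - Y) \<le> measure Q A"
  proof -
    have "0 \<le> measure Q (A - Y) + \<epsilon> * \<rho> (A - Y)" by (rule nn) simp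
    also have "measure Q (A - Y) \<le> measure Q A"
      using Q A by (intro finite_measure_mono) (auto simp: borel_probs_iff)
    finally show ?thesis by simp
  qed
  then show ?lo
    using \<epsilon> sg[OF A] by (simp add: L emeasure_eq_measure ennreal_mult[symmetric] ennreal_leI)
  have "emeasure (total_variation \<rho>) A = ennreal (\<rho> (A \<inter> Y) - \<rho> (A - Y))"
    unfolding total_variation_def
  proof (rule emeasure_measure_of_sums)
    fix A :: "nat \<Rightarrow> 'a set" assume *: "range A \<subseteq> sets borel" "disjoint_family A"
    have "range (\<lambda>i. A i \<inter> Y) \<subseteq> sets borel" "disjoint_family (\<lambda>i. A i \<inter> Y)"
      "range (\<lambda>i. A i - Y) \<subseteq> sets borel" "disjoint_family (\<lambda>i. A i - Y)"
      using * by (auto simp: disjoint_family_on_def)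
    then have "(\<lambda>i. \<rho> (A i \<inter> Y)) sums \<rho> (\<Union>i. A i \<inter> Y)" and "(\<lambda>i. \<rho> (A i - Y)) sums \<rho> (\<Union>i. A i - Y)"
      by (simp_all only: signed_measure_sums[OF \<rho>])
    then have "(\<lambda>i. \<rho> (A i \<inter> Y) - \<rho> (A i - Y)) sums (\<rho> (\<Union>i. A i \<inter> Y) - \<rho> (\<Union>i. A i - Y))"
      by (rule sums_diff)
    then show "(\<lambda>i. \<rho> (A i \<inter> Y) - \<rho> (A i - Y)) sums (\<rho> ((\<Union>i. A i) \<inter> Y) - \<rho> ((\<Union>i. A i) - Y))"
      by simp
  qed (use sg in \<open>auto simp: U L ennreal_plus[symmetric] simp del: ennreal_plus intro: order_trans\<close>)
  then show ?tv
    using sg[OF A] by (simp add: U L ennreal_plus[symmetric] del: ennreal_plus)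
qed

text \<open>The Jordan parts are dominated by multiples of Q + \<epsilon> \<rho> and of Q, which
  gives their integrability; the Jordan identity for measures then turns into the affine dependence
  on \<epsilon> that the envelope argument needs.\<close>

lemma
  fixes Q :: "'a::euclidean_space measure"
  assumes Q: "Q \<in> borel_probs" and \<rho>: "signed_measure \<rho>" and p: "perturb_prob Q \<epsilon> \<rho>" and \<epsilon>: "0 < \<epsilon>"
    and f: "integrable Q f" "integrable (perturb Q \<epsilon> \<rho>) f"
  shows integrable_upper_variation: "integrable (upper_variation \<rho>) f"
    and integrable_lower_variation: "integrable (lower_variation \<rho>) f"
    and integral_perturb: "integral\<^sup>L (perturb Q \<epsilon> \<rho>) f = integral\<^sup>L Q f + \<epsilon> * signed_integral \<rho> f"
proof -
  have sQ: "sets Q = sets borel" using Q by (auto simp: borel_probs_iff)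
  have [measurable]: "f \<in> borel_measurable borel"
    using borel_measurable_integrable[OF f(1)] sQ measurable_cong_sets by blast
  note S = emeasure_perturb_Jordan[OF Q \<rho> p \<epsilon>] upper_variation_le[OF Q \<rho> p \<epsilon>] lower_variation_le[OF Q \<rho> p \<epsilon>]
  have "ennreal \<epsilon> * (\<integral>\<^sup>+x. norm (f x) \<partial>upper_variation \<rho>) + 0 * (\<integral>\<^sup>+x. norm (f x) \<partial>Q)
      \<le> 1 * (\<integral>\<^sup>+x. norm (f x) \<partial>perturb Q \<epsilon> \<rho>) + 0 * (\<integral>\<^sup>+x. norm (f x) \<partial>Q)"
    by (rule nn_integral_comb_mono[where M=borel]) (auto simp: S sQ)
  also have "\<dots> < \<infinity>" using f(2) by (simp add: integrable_iff_bounded)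
  finally show u: "integrable (upper_variation \<rho>) f"
    using \<epsilon> by (auto simp: integrable_iff_bounded ennreal_mult_less_top)
  have "ennreal \<epsilon> * (\<integral>\<^sup>+x. norm (f x) \<partial>lower_variation \<rho>) + 0 * (\<integral>\<^sup>+x. norm (f x) \<partial>Q)
      \<le> 1 * (\<integral>\<^sup>+x. norm (f x) \<partial>Q) + 0 * (\<integral>\<^sup>+x. norm (f x) \<partial>Q)"
    by (rule nn_integral_comb_mono[where M=borel]) (auto simp: S sQ)
  also have "\<dots> < \<infinity>" using f(1) by (simp add: integrable_iff_bounded)
  finally show l: "integrable (lower_variation \<rho>) f"
    using \<epsilon> by (auto simp: integrable_iff_bounded ennreal_mult_less_top)
  have "integral\<^sup>L (perturb Q \<epsilon> \<rho>) f + \<epsilon> * integral\<^sup>L (lower_variation \<rho>) f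
      = integral\<^sup>L Q f + \<epsilon> * integral\<^sup>L (upper_variation \<rho>) f"
    by (rule integral_comb_eq[where M=borel]) (use \<epsilon> in \<open>simp_all add: S sQ f u l\<close>)
  then show "integral\<^sup>L (perturb Q \<epsilon> \<rho>) f = integral\<^sup>L Q f + \<epsilon> * signed_integral \<rho> f"
    by (simp add: signed_integral_def algebra_simps)
qed

text \<open>Q + \<epsilon> \<rho> is dominated by Q plus \<epsilon> times the total variation. The
  moment clause of admissibility thus keeps Lipschitz functions integrable along the
  perturbation.\<close>

lemma finite_first_moment_perturb:
  fixes Q :: "'a::euclidean_space measure"
  assumes Q: "Q \<in> borel_probs" "finite_first_moment Q" and \<rho>: "right_admissible Q \<rho>"
    and p: "perturb_prob Q \<epsilon> \<rho>" and \<epsilon>: "0 < \<epsilon>"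
  shows "finite_first_moment (perturb Q \<epsilon> \<rho>)"
proof -
  have sQ: "sets Q = sets borel" using Q by (auto simp: borel_probs_iff)
  have s: "signed_measure \<rho>" and m: "(\<integral>\<^sup>+ x. ennreal (norm x) \<partial>total_variation \<rho>) < \<infinity>"
    using \<rho> by (auto simp: right_admissible_def)
  have "1 * (\<integral>\<^sup>+x. norm x \<partial>perturb Q \<epsilon> \<rho>) + 0 * (\<integral>\<^sup>+x. norm x \<partial>Q)
     \<le> 1 * (\<integral>\<^sup>+x. norm x \<partial>Q) + ennreal \<epsilon> * (\<integral>\<^sup>+x. norm x \<partial>total_variation \<rho>)"
  proof (rule nn_integral_comb_mono[where M=borel])
    fix A :: "'a set" assume A: "A \<in> sets borel"
    have "emeasure (perturb Q \<epsilon> \<rho>) A \<le> emeasure (perturb Q \<epsilon> \<rho>) A + ennreal \<epsilon> * emeasure (lower_variation \<rho>) A"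
      by simp
    also have "\<dots> = emeasure Q A + ennreal \<epsilon> * emeasure (upper_variation \<rho>) A"
      by (rule emeasure_perturb_Jordan[OF Q(1) s p \<epsilon> A])
    also have "\<dots> \<le> emeasure Q A + ennreal \<epsilon> * emeasure (total_variation \<rho>) A"
      by (intro add_left_mono mult_left_mono) (simp_all add: emeasure_total_variation[OF Q(1) s p \<epsilon> A])
    finally show "1 * emeasure (perturb Q \<epsilon> \<rho>) A + 0 * emeasure Q A \<le> 1 * emeasure Q A + ennreal \<epsilon> * emeasure (total_variation \<rho>) A"
      by simp
  qed (simp_all add: sQ)
  also have "\<dots> < \<infinity>"
    using m Q(2) by (simp add: finite_first_moment_def integrable_iff_bounded ennreal_mult_less_top)
  finally show ?thesis
    by (simp add: finite_first_moment_def integrable_iff_bounded)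
qed

section \<open>Integrability of Lipschitz functions and a criterion for admissibility\<close>

lemma borel_measurable_lipschitz:
  fixes f :: "'a::euclidean_space \<Rightarrow> real"
  shows "K-lipschitz_on UNIV f \<Longrightarrow> f \<in> borel_measurable borel"
  by (intro borel_measurable_continuous_onI lipschitz_on_continuous_on)

lemma integrable_lipschitz:
  fixes f :: "'a::euclidean_space \<Rightarrow> real"
  assumes f: "K-lipschitz_on UNIV f" and R: "R \<in> borel_probs" "finite_first_moment R"
  shows "integrable R f"
proof -
  interpret prob_space R using R by (simp add: borel_probs_iff)
  show ?thesis
  proof (rule Bochner_Integration.integrable_bound)
    show "integrable R (\<lambda>x. \<bar>f 0\<bar> + K * norm x)"
      using R(2) by (simp add: finite_first_moment_def)
    show "f \<in> borel_measurable R"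
      using borel_measurable_lipschitz[OF f] R(1) by (simp add: borel_probs_iff cong: measurable_cong_sets)
    have "\<bar>f x\<bar> \<le> \<bar>\<bar>f 0\<bar> + K * norm x\<bar>" for x
      using lipschitz_onD[OF f, of x 0] by (auto simp: dist_real_def)
    then show "AE x in R. norm (f x) \<le> norm (\<bar>f 0\<bar> + K * norm x)" by simp
  qed
qed

text \<open>\<epsilon> times the total variation is at most (Q + \<epsilon> \<rho>) + Q, so one
  single \<epsilon> with finite first moment controls both the mass and the moment of the total
  variation.\<close>

lemma right_admissibleI:
  fixes Q :: "'a::euclidean_space measure"
  assumes Q: "Q \<in> borel_probs" "finite_first_moment Q" and s: "signed_measure \<rho>" "\<rho> UNIV = 0"
    and ev: "\<forall>\<^sub>F \<epsilon> in at_right 0. perturb_prob Q \<epsilon> \<rho>"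
    and p: "perturb_prob Q \<epsilon> \<rho>" "0 < \<epsilon>" and m: "finite_first_moment (perturb Q \<epsilon> \<rho>)"
  shows "right_admissible Q \<rho>"
proof -
  have sQ: "sets Q = sets borel" and "prob_space Q" using Q by (auto simp: borel_probs_iff)
  interpret Q: prob_space Q by fact
  interpret R: prob_space "perturb Q \<epsilon> \<rho>" using p by (simp add: perturb_prob_def borel_probs_iff)
  note S = upper_variation_le[OF Q(1) s(1) p] lower_variation_le[OF Q(1) s(1) p]
    emeasure_total_variation[OF Q(1) s(1) p]
  have le: "ennreal \<epsilon> * emeasure (total_variation \<rho>) A + 0 * emeasure Q A
      \<le> 1 * emeasure (perturb Q \<epsilon> \<rho>) A + 1 * emeasure Q A" if "A \<in> sets borel" for A
    using S[OF that] by (simp add: distrib_left add_mono)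
  have "ennreal \<epsilon> * emeasure (total_variation \<rho>) UNIV \<le> emeasure (perturb Q \<epsilon> \<rho>) UNIV + emeasure Q UNIV"
    using le[of UNIV] by simp
  also have "\<dots> < \<infinity>" by (simp add: Q.emeasure_eq_measure R.emeasure_eq_measure)
  finally have 1: "emeasure (total_variation \<rho>) UNIV < \<infinity>"
    using p(2) by (auto simp: ennreal_mult_less_top)
  have "ennreal \<epsilon> * (\<integral>\<^sup>+x. norm x \<partial>total_variation \<rho>) + 0 * (\<integral>\<^sup>+x. norm x \<partial>Q)
      \<le> 1 * (\<integral>\<^sup>+x. norm x \<partial>perturb Q \<epsilon> \<rho>) + 1 * (\<integral>\<^sup>+x. norm x \<partial>Q)"
    by (rule nn_integral_comb_mono[where M=borel]) (simp_all add: le[simplified] sQ)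
  also have "\<dots> < \<infinity>" using m Q(2) by (simp add: finite_first_moment_def integrable_iff_bounded)
  finally have "(\<integral>\<^sup>+x. norm x \<partial>total_variation \<rho>) < \<infinity>"
    using p(2) by (auto simp: ennreal_mult_less_top)
  with 1 show ?thesis using s ev by (simp add: right_admissible_def)
qed

lemma right_admissible_ex:
  assumes "right_admissible Q \<rho>"
  obtains \<epsilon> where "0 < \<epsilon>" "perturb_prob Q \<epsilon> \<rho>"
proof -
  have "\<forall>\<^sub>F \<epsilon> in at_right 0. perturb_prob Q \<epsilon> \<rho> \<and> 0 < \<epsilon>"
    using assms eventually_at_right_less[of "0::real"] by (auto simp: right_admissible_def eventually_conj_iff)
  then show thesis
    using that eventually_happens'[OF trivial_limit_at_right_real] by blast
qed

section \<open>The Rockafellar--Uryasev formula\<close>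

definition ru_objective :: "real \<Rightarrow> ('a::euclidean_space \<Rightarrow> real) \<Rightarrow> 'a measure \<Rightarrow> real \<Rightarrow> real" where
  "ru_objective \<alpha> g R y = y + (\<integral>x. h_fun \<alpha> g y x \<partial>R)"

text \<open>Collects what the formula requires of one measure, because it is instantiated at Q, at
  the perturbed measures, and at pairs of measures compared in W1.\<close>

locale cvar_space = prob_space R for R :: "'a::euclidean_space measure" +
  fixes g :: "'a \<Rightarrow> real" and \<alpha> :: real
  assumes sets_R [simp, measurable_cong]: "sets R = sets borel"
    and g_nonneg: "\<And>x. 0 \<le> g x" and g_int: "integrable R g"
    and \<alpha>: "0 < \<alpha>" "\<alpha> < 1"
begin

lemma space_R [simp]: "space R = UNIV"
  using sets_eq_imp_space_eq[OF sets_R] by simp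

lemma g_meas [measurable]: "g \<in> borel_measurable borel"
  using borel_measurable_integrable[OF g_int] by (simp cong: measurable_cong_sets)

text \<open>Gives access to right continuity and to the limit 1 at infinity of distribution
  functions.\<close>

lemma Psi_eq_cdf: "Psi R g = cdf (distr R borel g)"
  by (auto simp: Psi_def cdf_def fun_eq_iff measure_distr vimage_def)

lemma Psi_mono: "c \<le> d \<Longrightarrow> Psi R g c \<le> Psi R g d"
  unfolding Psi_def by (intro finite_measure_mono) auto

lemma Psi_compl: "measure R {x. c < g x} = 1 - Psi R g c"
  using prob_compl[of "{x. g x \<le> c}"] by (simp add: Psi_def Compl_eq_Diff_UNIV[symmetric] Collect_neg_eq[symmetric] not_le)

lemma Psi_neg: "c < 0 \<Longrightarrow> Psi R g c = 0"
proof -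
  assume "c < 0"
  then have "{x. g x \<le> c} = {}" using g_nonneg by (auto simp: set_eq_iff not_le intro: order.strict_trans2)
  then show ?thesis by (simp add: Psi_def)
qed

lemma Psi_gt_ex: "\<exists>c. \<alpha> < Psi R g c"
proof -
  interpret D: real_distribution "distr R borel g" by (intro real_distribution_distr) simp
  have "\<forall>\<^sub>F c in at_top. \<alpha> < cdf (distr R borel g) c"
    using D.cdf_lim_at_top_prob \<alpha> by (intro order_tendstoD)
  then show ?thesis
    unfolding Psi_eq_cdf using eventually_happens'[OF trivial_limit_at_top_linorder] by blast
qed

text \<open>Real \<open>Inf\<close> is informative only for nonempty sets bounded below. The bound 0
  comes from the nonnegativity of g and 0 < \<alpha>.\<close>

lemma VaR_bdd_below: "bdd_below {c. \<alpha> \<le> Psi R g c}" "bdd_below {c. \<alpha> < Psi R g c}"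
proof -
  have "0 \<le> c" if "\<alpha> \<le> Psi R g c" for c using that Psi_neg[of c] \<alpha> by (cases "c < 0") auto
  then show "bdd_below {c. \<alpha> \<le> Psi R g c}" "bdd_below {c. \<alpha> < Psi R g c}" by (auto intro!: bdd_belowI[of _ 0])
qed

lemma VaR_le_upper: "VaR \<alpha> R g \<le> VaR_upper \<alpha> R g"
  unfolding VaR_def VaR_upper_def using Psi_gt_ex VaR_bdd_below by (intro cInf_superset_mono) auto

lemma Psi_less: "c < VaR \<alpha> R g \<Longrightarrow> Psi R g c < \<alpha>"
  unfolding VaR_def using cInf_lower[OF _ VaR_bdd_below(1), of c] by (force simp: not_le[symmetric])

lemma Psi_le: "c < VaR_upper \<alpha> R g \<Longrightarrow> Psi R g c \<le> \<alpha>"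
  unfolding VaR_upper_def using cInf_lower[OF _ VaR_bdd_below(2), of c] by (force simp: not_le[symmetric])

lemma Psi_greater: "VaR_upper \<alpha> R g < c \<Longrightarrow> \<alpha> < Psi R g c"
  unfolding VaR_upper_def using Psi_gt_ex VaR_bdd_below(2) Psi_mono
  by (subst (asm) cInf_less_iff) (auto intro: order.strict_trans2)

text \<open>Right continuity of the distribution function makes the infimum in the definition of VaR
  attained.\<close>

lemma Psi_VaR: "\<alpha> \<le> Psi R g (VaR \<alpha> R g)"
proof -
  interpret D: real_distribution "distr R borel g" by (intro real_distribution_distr) simp
  have lim: "(Psi R g \<longlongrightarrow> Psi R g (VaR \<alpha> R g)) (at_right (VaR \<alpha> R g))"
    using D.cdf_is_right_cont unfolding Psi_eq_cdf continuous_within by blast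
  have "\<alpha> \<le> Psi R g c" if "VaR \<alpha> R g < c" for c
    using that unfolding VaR_def
    by (subst (asm) cInf_less_iff) (use Psi_gt_ex VaR_bdd_below(1) Psi_mono in \<open>auto intro: order.trans less_imp_le\<close>)
  then show ?thesis
    by (intro tendsto_lowerbound[OF lim]) (auto simp: eventually_at_filter)
qed

lemma h_fun_integrable: "integrable R (h_fun \<alpha> g y)"
  unfolding h_fun_def[abs_def]
  by (intro Bochner_Integration.integrable_bound[OF Bochner_Integration.integrable_add[OF g_int integrable_const[of "\<bar>y\<bar>"]], THEN integrable_divide_zero])
     (auto simp: g_nonneg intro!: AE_I2)

section \<open>Slopes, minimizers and growth of the convex objective\<close>

lemma ru_slope:
  assumes "y \<le> z"
  shows "(z - y) * (Psi R g y - \<alpha>) / (1 - \<alpha>) \<le> ru_objective \<alpha> g R z - ru_objective \<alpha> g R y"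
    and "ru_objective \<alpha> g R z - ru_objective \<alpha> g R y \<le> (z - y) * (Psi R g z - \<alpha>) / (1 - \<alpha>)"
proof -
  let ?d = "\<lambda>x. h_fun \<alpha> g y x - h_fun \<alpha> g z x"
  have ind: "(\<integral>x. (z - y) / (1 - \<alpha>) * indicator {x. c < g x} x \<partial>R) = (z - y) / (1 - \<alpha>) * (1 - Psi R g c)" for c
    by (simp add: Psi_compl)
  have int: "integrable R (\<lambda>x. (z - y) / (1 - \<alpha>) * indicator {x. c < g x} x)" for c
    by (intro integrable_mult_right) (auto simp: integrable_indicator_iff emeasure_eq_measure)
  have d: "integrable R ?d" by (intro Bochner_Integration.integrable_diff h_fun_integrable)
  have diff: "ru_objective \<alpha> g R z - ru_objective \<alpha> g R y = (z - y) - (\<integral>x. ?d x \<partial>R)"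
    by (simp add: ru_objective_def h_fun_integrable)
  have pt: "?d x \<le> (z - y) / (1 - \<alpha>) * indicator {x. y < g x} x"
    "(z - y) / (1 - \<alpha>) * indicator {x. z < g x} x \<le> ?d x" for x
    using assms \<alpha> unfolding h_fun_def diff_divide_distrib[symmetric] times_divide_eq_left
    by (auto intro!: divide_right_mono simp: indicator_def)
  have alg: "(z - y) - (z - y) / (1 - \<alpha>) * (1 - p) = (z - y) * (p - \<alpha>) / (1 - \<alpha>)" for p
    using \<alpha> by (simp add: field_simps)
  have "(\<integral>x. ?d x \<partial>R) \<le> (z - y) / (1 - \<alpha>) * (1 - Psi R g y)"
    unfolding ind[symmetric] by (intro integral_mono d int pt)
  then show "(z - y) * (Psi R g y - \<alpha>) / (1 - \<alpha>) \<le> ru_objective \<alpha> g R z - ru_objective \<alpha> g R y"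
    unfolding diff alg[symmetric] by simp
  have "(z - y) / (1 - \<alpha>) * (1 - Psi R g z) \<le> (\<integral>x. ?d x \<partial>R)"
    unfolding ind[symmetric] by (intro integral_mono d int pt)
  then show "ru_objective \<alpha> g R z - ru_objective \<alpha> g R y \<le> (z - y) * (Psi R g z - \<alpha>) / (1 - \<alpha>)"
    unfolding diff alg[symmetric] by simp
qed

text \<open>Both \<alpha> and the distribution function lie in [0, 1], so slopes are at most 1 / (1
  - \<alpha>) in absolute value.\<close>

lemma ru_lipschitz: "\<bar>ru_objective \<alpha> g R z - ru_objective \<alpha> g R y\<bar> \<le> 1 / (1 - \<alpha>) * \<bar>z - y\<bar>"
proof -
  have *: "\<bar>(z - y) * (p - \<alpha>) / (1 - \<alpha>)\<bar> \<le> 1 / (1 - \<alpha>) * (z - y)" if "y \<le> z" "0 \<le> p" "p \<le> 1" for y z p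
  proof -
    have "\<bar>(z - y) * (p - \<alpha>) / (1 - \<alpha>)\<bar> = (z - y) / (1 - \<alpha>) * \<bar>p - \<alpha>\<bar>"
      using that \<alpha> by (simp add: abs_mult)
    also have "\<dots> \<le> (z - y) / (1 - \<alpha>) * 1" using that \<alpha> by (intro mult_left_mono) auto
    finally show ?thesis by simp
  qed
  have Psi01: "0 \<le> Psi R g c" "Psi R g c \<le> 1" for c by (simp_all add: Psi_def)
  have "\<bar>ru_objective \<alpha> g R z - ru_objective \<alpha> g R y\<bar> \<le> 1 / (1 - \<alpha>) * (z - y)" if "y \<le> z" for y z
    using ru_slope[OF that] *[OF that Psi01, of y] *[OF that Psi01, of z]
    by linarith
  from this[of y z] this[of z y] show ?thesis by (cases "y \<le> z") (auto simp: abs_minus_commute)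
qed

lemma ru_continuous: "continuous_on UNIV (ru_objective \<alpha> g R)"
  using ru_lipschitz \<alpha>
  by (intro lipschitz_on_continuous_on[of "1 / (1 - \<alpha>)"] lipschitz_onI) (auto simp: dist_real_def)

lemma ru_at_left: "(ru_objective \<alpha> g R \<longlongrightarrow> ru_objective \<alpha> g R y) (at_left y)"
  using ru_continuous by (metis UNIV_I continuous_on_def tendsto_within_subset top_greatest)

lemma CVaR_eq_ru_VaR: "CVaR \<alpha> R g = ru_objective \<alpha> g R (VaR \<alpha> R g)"
proof -
  define v where "v = VaR \<alpha> R g"
  define p where "p = Psi R g v"
  define e where "e = (\<integral>x. indicator {x. v < g x} x * g x \<partial>R)"
  have int: "integrable R (\<lambda>x. indicator {x. v < g x} x * g x)" "integrable R (\<lambda>x. indicator {x. v < g x} x * v)"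
    using g_int by (auto intro!: integrable_real_mult_indicator simp: mult.commute integrable_indicator_iff emeasure_eq_measure)
  have "(\<integral>x. h_fun \<alpha> g v x \<partial>R) = (\<integral>x. (indicator {x. v < g x} x * g x - indicator {x. v < g x} x * v) / (1 - \<alpha>) \<partial>R)"
    by (intro Bochner_Integration.integral_cong) (auto simp: h_fun_def indicator_def)
  also have "\<dots> = (e - (1 - p) * v) / (1 - \<alpha>)"
    using int by (simp add: e_def p_def Psi_compl)
  finally have ru: "ru_objective \<alpha> g R v = v + (e - (1 - p) * v) / (1 - \<alpha>)"
    by (simp add: ru_objective_def)
  \<comment> \<open>For p = 1 the quotient is 0 by the convention for division by zero; the equation
    survives because {g > v} is then null and e vanishes.\<close>
  have "(1 - p) * (e / (1 - p)) = e"
  proof (cases "p = 1")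
    case True
    then have "R {x. v < g x} = 0" by (simp add: emeasure_eq_measure Psi_compl p_def[symmetric])
    then have "AE x in R. indicator {x. v < g x} x * g x = 0"
      by (intro AE_I[of _ _ "{x. v < g x}"]) (auto simp: indicator_def)
    then have "e = 0" unfolding e_def by (rule integral_eq_zero_AE)
    then show ?thesis by simp
  qed simp
  then have "(1 - p) / (1 - \<alpha>) * (e / (1 - p)) = e / (1 - \<alpha>)"
    by (metis times_divide_eq_left)
  moreover have "cond_expect_above R g v = e / (1 - p)"
    by (simp add: cond_expect_above_def set_lebesgue_integral_def e_def p_def Psi_compl)
  moreover have "CVaR_weight \<alpha> R g = (p - \<alpha>) / (1 - \<alpha>)" "1 - (p - \<alpha>) / (1 - \<alpha>) = (1 - p) / (1 - \<alpha>)"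
    using \<alpha> by (simp_all add: CVaR_weight_def p_def v_def field_simps)
  ultimately have "CVaR \<alpha> R g = (p - \<alpha>) / (1 - \<alpha>) * v + e / (1 - \<alpha>)"
    by (simp only: CVaR_def v_def[symmetric])
  also have "\<dots> = v + (e - (1 - p) * v) / (1 - \<alpha>)"
    using \<alpha> by (simp add: divide_simps) (simp add: algebra_simps)
  finally show ?thesis using ru unfolding v_def by simp
qed

lemma CVaR_le_ru: "CVaR \<alpha> R g \<le> ru_objective \<alpha> g R y"
  unfolding CVaR_eq_ru_VaR
proof (cases "VaR \<alpha> R g \<le> y")
  case True
  have "0 \<le> (y - VaR \<alpha> R g) * (Psi R g (VaR \<alpha> R g) - \<alpha>) / (1 - \<alpha>)"
    using True Psi_VaR \<alpha> by simp
  with ru_slope(1)[OF True] show "ru_objective \<alpha> g R (VaR \<alpha> R g) \<le> ru_objective \<alpha> g R y" by linarith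
next
  case False
  show "ru_objective \<alpha> g R (VaR \<alpha> R g) \<le> ru_objective \<alpha> g R y"
  \<comment> \<open>The upper slope bound uses Psi at the right end, which at VaR itself is at least
    \<alpha>. Strictly to the left Psi is below \<alpha>, so the comparison is made there and
    carried to VaR by continuity.\<close>
  proof (rule tendsto_upperbound[OF ru_at_left])
    have "\<forall>\<^sub>F z in at_left (VaR \<alpha> R g). y < z \<and> z < VaR \<alpha> R g"
      using False eventually_at_left_real[of y "VaR \<alpha> R g"] by simp
    then show "\<forall>\<^sub>F z in at_left (VaR \<alpha> R g). ru_objective \<alpha> g R z \<le> ru_objective \<alpha> g R y"
    proof eventually_elim
      case (elim z)
      have "(z - y) * (Psi R g z - \<alpha>) / (1 - \<alpha>) \<le> 0"
        using elim Psi_less[of z] \<alpha> by (intro divide_nonpos_nonneg mult_nonneg_nonpos) auto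
      with ru_slope(2)[of y z] elim show ?case by linarith
    qed
  qed simp
qed

lemma CVaR_eq_ru:
  assumes "y \<in> T_set \<alpha> R g"
  shows "CVaR \<alpha> R g = ru_objective \<alpha> g R y"
proof (rule antisym[OF CVaR_le_ru])
  let ?v = "VaR \<alpha> R g"
  have *: "ru_objective \<alpha> g R z \<le> ru_objective \<alpha> g R ?v" if "?v \<le> z" "z < VaR_upper \<alpha> R g" for z
  proof -
    have "(z - ?v) * (Psi R g z - \<alpha>) / (1 - \<alpha>) \<le> 0"
      using that Psi_le[of z] \<alpha> by (intro divide_nonpos_nonneg mult_nonneg_nonpos) auto
    with ru_slope(2)[OF that(1)] show ?thesis by linarith
  qed
  show "ru_objective \<alpha> g R y \<le> CVaR \<alpha> R g"
  \<comment> \<open>Psi can jump above \<alpha> at \<open>VaR_upper\<close>, so the slope bound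
    stops short of this endpoint; it is reached as a limit from the left.\<close>
  proof (cases "?v < y \<and> y = VaR_upper \<alpha> R g")
    case True
    then have "\<forall>\<^sub>F z in at_left y. ?v < z \<and> z < y"
      using eventually_at_left_real[of ?v y] by simp
    then show ?thesis unfolding CVaR_eq_ru_VaR
      by (intro tendsto_upperbound[OF ru_at_left]) (auto elim!: eventually_mono intro!: * simp: True)
  next
    case False
    then show ?thesis using assms * unfolding CVaR_eq_ru_VaR T_set_def by force
  qed
qed

text \<open>Off T(Q) the slopes are bounded away from 0, by convexity. A linear rate, rather than a
  mere positive gap, is needed to absorb a perturbation that is itself linear in the distance from
  T(Q).\<close>

lemma ru_growth:
  assumes "0 < \<delta>"
  obtains s where "0 < s"
    "\<And>y. VaR_upper \<alpha> R g + \<delta> \<le> y \<Longrightarrow> CVaR \<alpha> R g + s * (y - VaR_upper \<alpha> R g) \<le> ru_objective \<alpha> g R y"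
    "\<And>y. y \<le> VaR \<alpha> R g - \<delta> \<Longrightarrow> CVaR \<alpha> R g + s * (VaR \<alpha> R g - y) \<le> ru_objective \<alpha> g R y"
proof -
  define a b where "a = VaR \<alpha> R g - \<delta> / 2" and "b = VaR_upper \<alpha> R g + \<delta> / 2"
  \<comment> \<open>Slopes are taken at a and b, half-way into the margin \<delta>. The factor 1/2
    pays for measuring distances from the ends of T(Q): beyond the margin they are at most twice the
    distances from a and b.\<close>
  define s where "s = min (Psi R g b - \<alpha>) (\<alpha> - Psi R g a) / (1 - \<alpha>) / 2"
  have "2 * s = min (Psi R g b - \<alpha>) (\<alpha> - Psi R g a) / (1 - \<alpha>)"
    unfolding s_def by (rule nonzero_mult_div_cancel_left[where a="2::real", unfolded times_divide_eq_right[symmetric]]) simp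
  then have s: "0 < s" "2 * s \<le> (Psi R g b - \<alpha>) / (1 - \<alpha>)" "2 * s \<le> (\<alpha> - Psi R g a) / (1 - \<alpha>)"
    using assms \<alpha> Psi_greater[of b] Psi_less[of a]
    by (simp_all add: s_def a_def b_def divide_right_mono)
  show thesis
  proof (rule that[OF s(1)])
    fix y assume y: "VaR_upper \<alpha> R g + \<delta> \<le> y"
    have "s * (y - VaR_upper \<alpha> R g) \<le> s * (2 * (y - b))"
      using y s(1) by (intro mult_left_mono) (auto simp: b_def)
    also have "\<dots> = (y - b) * (2 * s)" by simp
    also have "\<dots> \<le> (y - b) * ((Psi R g b - \<alpha>) / (1 - \<alpha>))"
      using y s(2) assms by (intro mult_left_mono) (auto simp: b_def)
    also have "\<dots> \<le> ru_objective \<alpha> g R y - ru_objective \<alpha> g R b"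
      using ru_slope(1)[of b y] y assms by (simp add: b_def)
    finally show "CVaR \<alpha> R g + s * (y - VaR_upper \<alpha> R g) \<le> ru_objective \<alpha> g R y"
      using CVaR_le_ru[of b] by linarith
  next
    fix y assume y: "y \<le> VaR \<alpha> R g - \<delta>"
    have "s * (VaR \<alpha> R g - y) \<le> s * (2 * (a - y))"
      using y s(1) by (intro mult_left_mono) (auto simp: a_def)
    also have "\<dots> = (a - y) * (2 * s)" by simp
    also have "\<dots> \<le> (a - y) * ((\<alpha> - Psi R g a) / (1 - \<alpha>))"
      using y s(3) assms by (intro mult_left_mono) (auto simp: a_def)
    also have "\<dots> = - ((a - y) * (Psi R g a - \<alpha>) / (1 - \<alpha>))"
      by (metis minus_diff_eq minus_divide_left mult_minus_right times_divide_eq_right)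
    also have "\<dots> \<le> ru_objective \<alpha> g R y - ru_objective \<alpha> g R a"
      using ru_slope(2)[of y a] y assms by (simp add: a_def)
    finally show "CVaR \<alpha> R g + s * (VaR \<alpha> R g - y) \<le> ru_objective \<alpha> g R y"
      using CVaR_le_ru[of a] by linarith
  qed
qed

end

section \<open>The Wasserstein distance\<close>

definition transport_cost :: "('a::euclidean_space \<times> 'a) measure \<Rightarrow> ennreal" where
  "transport_cost \<pi> = (\<integral>\<^sup>+ z. ennreal (dist (fst z) (snd z)) \<partial>\<pi>)"

lemma W1_le: "\<pi> \<in> couplings Q R \<Longrightarrow> W1 Q R \<le> transport_cost \<pi>"
  unfolding W1_def transport_cost_def by (rule INF_lower)

lemma W1_less_ex: "W1 Q R < c \<Longrightarrow> \<exists>\<pi>\<in>couplings Q R. transport_cost \<pi> < c"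
  unfolding W1_def transport_cost_def by (simp add: INF_less_iff)

lemma W1_greatest: "(\<And>\<pi>. \<pi> \<in> couplings Q R \<Longrightarrow> c \<le> transport_cost \<pi>) \<Longrightarrow> c \<le> W1 Q R"
  unfolding W1_def transport_cost_def by (rule INF_greatest)

lemma couplings_iff:
  "\<pi> \<in> couplings Q R \<longleftrightarrow> sets \<pi> = sets (borel \<Otimes>\<^sub>M borel) \<and> prob_space \<pi> \<and>
     distr \<pi> borel fst = Q \<and> distr \<pi> borel snd = R"
  by (simp add: couplings_def space_prob_algebra)

lemma couplingsD:
  assumes "\<pi> \<in> couplings Q R"
  shows "sets \<pi> = sets (borel \<Otimes>\<^sub>M borel)" "prob_space \<pi>" "distr \<pi> borel fst = Q" "distr \<pi> borel snd = R"
  using assms by (auto simp: couplings_iff)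

lemma nn_integral_couplings:
  assumes \<pi>: "\<pi> \<in> couplings Q R" and f[measurable]: "f \<in> borel_measurable borel"
  shows "(\<integral>\<^sup>+z. f (fst z) \<partial>\<pi>) = integral\<^sup>N Q f" "(\<integral>\<^sup>+z. f (snd z) \<partial>\<pi>) = integral\<^sup>N R f"
proof -
  note [measurable_cong] = couplingsD(1)[OF \<pi>]
  show "(\<integral>\<^sup>+z. f (fst z) \<partial>\<pi>) = integral\<^sup>N Q f" "(\<integral>\<^sup>+z. f (snd z) \<partial>\<pi>) = integral\<^sup>N R f"
    unfolding couplingsD(3,4)[OF \<pi>, symmetric] by (simp_all add: nn_integral_distr)
qed

text \<open>Marginals are tested by integrals of indicators, because the couplings constructed below
  are known through their integration formula.\<close>

lemma couplingsI:
  assumes s: "sets \<pi> = sets (borel \<Otimes>\<^sub>M borel)" and Q: "Q \<in> borel_probs" and R: "R \<in> borel_probs"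
    and 1: "\<And>A. A \<in> sets borel \<Longrightarrow> (\<integral>\<^sup>+z. indicator A (fst z) \<partial>\<pi>) = emeasure Q A"
    and 2: "\<And>A. A \<in> sets borel \<Longrightarrow> (\<integral>\<^sup>+z. indicator A (snd z) \<partial>\<pi>) = emeasure R A"
  shows "\<pi> \<in> couplings Q R"
proof -
  note [measurable_cong] = s
  have sQ: "sets Q = sets borel" "sets R = sets borel" "emeasure Q UNIV = 1"
    using Q R prob_space.emeasure_space_1[of Q] sets_eq_imp_space_eq[of Q borel] by (auto simp: borel_probs_iff)
  have E: "emeasure (distr \<pi> borel f) A = (\<integral>\<^sup>+z. indicator A (f z) \<partial>\<pi>)"
    if "f \<in> measurable \<pi> borel" "A \<in> sets borel" for f and A :: "'a set"
    using nn_integral_distr[OF that(1), of "indicator A"] that(2) by simp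
  have d: "distr \<pi> borel fst = Q" "distr \<pi> borel snd = R"
    by (rule measure_eqI; simp add: sQ E 1 2)+
  have "emeasure \<pi> (space \<pi>) = (\<integral>\<^sup>+z. indicator UNIV (fst z) \<partial>\<pi>)" by simp
  also have "\<dots> = 1" using 1[of UNIV] sQ by simp
  finally have "prob_space \<pi>" by (rule prob_spaceI)
  with d s show ?thesis by (simp add: couplings_iff)
qed

lemma W1_commute: "W1 Q R = W1 R Q"
proof -
  have "W1 R Q \<le> W1 Q R" for Q R :: "'b::euclidean_space measure"
  proof (rule W1_greatest)
    fix \<pi> assume \<pi>: "\<pi> \<in> couplings Q R"
    note [measurable_cong] = couplingsD(1)[OF \<pi>]
    interpret prob_space \<pi> using \<pi> by (rule couplingsD)
    let ?\<pi> = "distr \<pi> (borel \<Otimes>\<^sub>M borel) (\<lambda>z. (snd z, fst z))"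
    have "?\<pi> \<in> couplings R Q"
      using couplingsD[OF \<pi>] by (auto simp: couplings_iff distr_distr comp_def intro!: prob_space_distr)
    then have "W1 R Q \<le> transport_cost ?\<pi>" by (rule W1_le)
    also have "\<dots> = transport_cost \<pi>"
      by (simp add: transport_cost_def nn_integral_distr dist_commute)
    finally show "W1 R Q \<le> transport_cost \<pi>" .
  qed
  then show ?thesis by (intro antisym)
qed

lemma W1_self:
  assumes Q: "Q \<in> borel_probs"
  shows "W1 Q Q = 0"
proof -
  have sQ[measurable_cong]: "sets Q = sets borel" using Q by (simp add: borel_probs_iff)
  let ?\<pi> = "distr Q (borel \<Otimes>\<^sub>M borel) (\<lambda>x. (x, x))"
  have "?\<pi> \<in> couplings Q Q"
    by (rule couplingsI[OF _ Q Q]) (simp_all add: nn_integral_distr sQ)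
  then have "W1 Q Q \<le> transport_cost ?\<pi>" by (rule W1_le)
  also have "\<dots> = 0" by (simp add: transport_cost_def nn_integral_distr)
  finally show ?thesis by simp
qed

section \<open>Gluing of couplings and the triangle inequality\<close>

text \<open>A density for the product of two couplings: only pairs whose middle points lie in the
  same cell survive, normalized by the mass of the cell. A cell of mass 0 gets 1 / 0 = 0, which is
  harmless since it is null.\<close>

definition glue_weight :: "(nat \<Rightarrow> real) \<Rightarrow> nat \<Rightarrow> nat \<Rightarrow> ennreal" where
  "glue_weight m i j = (if i = j then ennreal (1 / m i) else 0)"

text \<open>Integrating out q leaves m(a p) / m(a p) = 1 for almost every p, so the density
  preserves the marginal M. General labels a and b let the same lemma serve for the other marginal
  with the roles exchanged.\<close>

lemma nn_integral_glue_weight: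
  fixes a :: "'b \<Rightarrow> nat" and b :: "'c \<Rightarrow> nat"
  assumes M: "prob_space M" and N: "prob_space N"
    and a[measurable]: "a \<in> measurable M (count_space UNIV)" and b[measurable]: "b \<in> measurable N (count_space UNIV)"
    and m: "\<And>n. measure M {p \<in> space M. a p = n} = m n" "\<And>n. measure N {q \<in> space N. b q = n} = m n"
    and f: "f \<in> borel_measurable M"
  shows "(\<integral>\<^sup>+p. (\<integral>\<^sup>+q. f p * glue_weight m (a p) (b q) \<partial>N) \<partial>M) = integral\<^sup>N M f"
proof (rule nn_integral_cong_AE)
  interpret M: prob_space M by fact
  interpret N: prob_space N by fact
  \<comment> \<open>Cells of mass 0 are countably many null sets; discarding them makes the
    normalization legitimate.\<close>
  have "AE p in M. a p = n \<longrightarrow> m n \<noteq> 0" for n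
  proof (cases "m n = 0")
    case True
    then have "emeasure M {p \<in> space M. a p = n} = 0" by (simp add: M.emeasure_eq_measure m)
    then show ?thesis by (intro AE_I'[of "{p \<in> space M. a p = n}"]) (auto simp: null_sets_def)
  qed simp
  then have "AE p in M. \<forall>n. a p = n \<longrightarrow> m n \<noteq> 0" unfolding AE_all_countable by blast
  then show "AE p in M. (\<integral>\<^sup>+q. f p * glue_weight m (a p) (b q) \<partial>N) = f p"
  proof eventually_elim
    case (elim p)
    have pos: "0 < m (a p)" using elim m(1)[of "a p", symmetric] by (simp add: less_le)
    have "(\<integral>\<^sup>+q. f p * glue_weight m (a p) (b q) \<partial>N)
        = (\<integral>\<^sup>+q. f p * ennreal (1 / m (a p)) * indicator {q \<in> space N. b q = a p} q \<partial>N)"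
      by (intro nn_integral_cong) (auto simp: glue_weight_def indicator_def)
    also have "\<dots> = f p * ennreal (1 / m (a p)) * ennreal (m (a p))"
      by (subst nn_integral_cmult_indicator) (auto simp: N.emeasure_eq_measure m)
    also have "\<dots> = f p"
      using pos by (simp add: mult.assoc ennreal_mult[symmetric])
    finally show ?case .
  qed
qed

text \<open>A point is labelled by the first member of a countable dense sequence within \<delta> /
  2 of it; the triangle inequality bounds each cell.\<close>

lemma fine_index_exists:
  assumes "0 < \<delta>"
  obtains i :: "'a::euclidean_space \<Rightarrow> nat" where
    "i \<in> measurable borel (count_space UNIV)" "\<And>x y. i x = i y \<Longrightarrow> dist x y \<le> \<delta>"
proof -
  obtain D :: "'a set" where D: "countable D" "\<And>X. open X \<Longrightarrow> X \<noteq> {} \<Longrightarrow> \<exists>d\<in>D. d \<in> X"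
    using countable_dense_setE by metis
  define d where "d = from_nat_into D"
  have "D \<noteq> {}" using D(2)[of UNIV] by auto
  then have rd: "range d = D" using D(1) by (simp add: d_def range_from_nat_into)
  define i where "i x = (LEAST n. dist x (d n) < \<delta> / 2)" for x
  have i: "dist x (d (i x)) < \<delta> / 2" for x
  proof -
    obtain n where "dist x (d n) < \<delta> / 2"
      using D(2)[of "ball x (\<delta> / 2)"] assms rd by auto
    then show ?thesis unfolding i_def by (rule LeastI)
  qed
  show thesis
  proof (rule that)
    show "i \<in> measurable borel (count_space UNIV)" unfolding i_def by measurable
    show "dist x y \<le> \<delta>" if "i x = i y" for x y
      using i[of x] i[of y] that dist_triangle2[of x y "d (i x)"] by simp
  qed
qed

text \<open>Two couplings with a common marginal are glued along a countable partition of the middle space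
  into cells of diameter at most \<open>\<delta>\<close>: within each cell they are coupled independently. This keeps the
  outer marginals exact and costs at most an extra \<open>\<delta>\<close>, so that no disintegration is needed.\<close>

lemma W1_triangle:
  fixes Q R S :: "'a::euclidean_space measure"
  assumes Q: "Q \<in> borel_probs" and S: "S \<in> borel_probs"
  shows "W1 Q S \<le> W1 Q R + W1 R S"
proof -
  have glue: "W1 Q S \<le> transport_cost \<pi> + transport_cost \<tau> + ennreal \<delta>"
    if \<pi>: "\<pi> \<in> couplings Q R" and \<tau>: "\<tau> \<in> couplings R S" and \<delta>: "0 < \<delta>" for \<pi> \<tau> \<delta>
  proof -
    obtain i :: "'a \<Rightarrow> nat" where i[measurable]: "i \<in> measurable borel (count_space UNIV)"
      and fine: "\<And>x y. i x = i y \<Longrightarrow> dist x y \<le> \<delta>"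
      using fine_index_exists[OF \<delta>] by metis
    note sets[measurable_cong] = couplingsD(1)[OF \<pi>] couplingsD(1)[OF \<tau>]
    interpret \<pi>: prob_space \<pi> using \<pi> by (rule couplingsD)
    interpret \<tau>: prob_space \<tau> using \<tau> by (rule couplingsD)
    interpret pair_prob_space \<pi> \<tau> ..
    define m where "m n = measure R {y. i y = n}" for n
    have m: "measure \<pi> {p \<in> space \<pi>. i (snd p) = n} = m n" "measure \<tau> {q \<in> space \<tau>. i (fst q) = n} = m n" for n
    proof -
      have "m n = measure (distr \<pi> borel snd) {y. i y = n}" by (simp add: m_def couplingsD(4)[OF \<pi>])
      then show "measure \<pi> {p \<in> space \<pi>. i (snd p) = n} = m n"
        by (subst (asm) measure_distr) (auto simp: vimage_def Int_def conj_commute)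
      have "m n = measure (distr \<tau> borel fst) {y. i y = n}" by (simp add: m_def couplingsD(3)[OF \<tau>])
      then show "measure \<tau> {q \<in> space \<tau>. i (fst q) = n} = m n"
        by (subst (asm) measure_distr) (auto simp: vimage_def Int_def conj_commute)
    qed
    define w where "w z = glue_weight m (i (snd (fst z))) (i (fst (snd z)))" for z :: "('a \<times> 'a) \<times> 'a \<times> 'a"
    have w_swap: "w (p, q) = glue_weight m (i (fst q)) (i (snd p))" for p q
      by (simp add: w_def glue_weight_def)
    have [measurable]: "w \<in> borel_measurable (\<pi> \<Otimes>\<^sub>M \<tau>)"
      unfolding w_def
    proof (rule measurable_compose_countable[where g="\<lambda>z. i (snd (fst z))"])
      show "(\<lambda>z. glue_weight m n (i (fst (snd z)))) \<in> borel_measurable (\<pi> \<Otimes>\<^sub>M \<tau>)" for n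
        by (rule measurable_compose[where g="glue_weight m n" and N="count_space UNIV"]) simp_all
    qed simp
    have F1: "(\<integral>\<^sup>+z. f (fst z) * w z \<partial>(\<pi> \<Otimes>\<^sub>M \<tau>)) = integral\<^sup>N \<pi> f" if [measurable]: "f \<in> borel_measurable \<pi>" for f
    proof -
      have "(\<integral>\<^sup>+z. f (fst z) * w z \<partial>(\<pi> \<Otimes>\<^sub>M \<tau>)) = (\<integral>\<^sup>+p. (\<integral>\<^sup>+q. f p * glue_weight m (i (snd p)) (i (fst q)) \<partial>\<tau>) \<partial>\<pi>)"
        by (subst \<tau>.nn_integral_fst[symmetric]) (simp_all add: w_def)
      also have "\<dots> = integral\<^sup>N \<pi> f"
        by (rule nn_integral_glue_weight) (use m \<pi>.prob_space_axioms \<tau>.prob_space_axioms in auto)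
      finally show ?thesis .
    qed
    have F2: "(\<integral>\<^sup>+z. f (snd z) * w z \<partial>(\<pi> \<Otimes>\<^sub>M \<tau>)) = integral\<^sup>N \<tau> f" if [measurable]: "f \<in> borel_measurable \<tau>" for f
    proof -
      have "(\<integral>\<^sup>+z. f (snd z) * w z \<partial>(\<pi> \<Otimes>\<^sub>M \<tau>)) = (\<integral>\<^sup>+q. (\<integral>\<^sup>+p. f q * glue_weight m (i (fst q)) (i (snd p)) \<partial>\<pi>) \<partial>\<tau>)"
        by (subst nn_integral_snd[symmetric]) (simp_all add: w_swap)
      also have "\<dots> = integral\<^sup>N \<tau> f"
        by (rule nn_integral_glue_weight) (use m \<pi>.prob_space_axioms \<tau>.prob_space_axioms in auto)
      finally show ?thesis .
    qed
    define \<sigma> where "\<sigma> = distr (density (\<pi> \<Otimes>\<^sub>M \<tau>) w) (borel \<Otimes>\<^sub>M borel) (\<lambda>z. (fst (fst z), snd (snd z)))"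
    have \<sigma>: "(\<integral>\<^sup>+z. f z \<partial>\<sigma>) = (\<integral>\<^sup>+z. f (fst (fst z), snd (snd z)) * w z \<partial>(\<pi> \<Otimes>\<^sub>M \<tau>))"
      if [measurable]: "f \<in> borel_measurable (borel \<Otimes>\<^sub>M borel)" for f
      unfolding \<sigma>_def by (simp add: nn_integral_distr nn_integral_density mult.commute)
    have "\<sigma> \<in> couplings Q S"
    proof (rule couplingsI[OF _ Q S])
      fix A :: "'a set" assume A[measurable]: "A \<in> sets borel"
      have sQ: "sets Q = sets borel" "sets S = sets borel" using Q S by (auto simp: borel_probs_iff)
      show "(\<integral>\<^sup>+z. indicator A (fst z) \<partial>\<sigma>) = emeasure Q A"
        using F1[of "\<lambda>p. indicator A (fst p)"] nn_integral_couplings(1)[OF \<pi>, of "indicator A"] by (simp add: \<sigma> sQ)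
      show "(\<integral>\<^sup>+z. indicator A (snd z) \<partial>\<sigma>) = emeasure S A"
        using F2[of "\<lambda>p. indicator A (snd p)"] nn_integral_couplings(2)[OF \<tau>, of "indicator A"] by (simp add: \<sigma> sQ)
    qed (simp add: \<sigma>_def)
    then have "W1 Q S \<le> transport_cost \<sigma>" by (rule W1_le)
    also have "\<dots> = (\<integral>\<^sup>+z. ennreal (dist (fst (fst z)) (snd (snd z))) * w z \<partial>(\<pi> \<Otimes>\<^sub>M \<tau>))"
      unfolding transport_cost_def by (subst \<sigma>) simp_all
    also have "\<dots> \<le> (\<integral>\<^sup>+z. (ennreal (dist (fst (fst z)) (snd (fst z))) + ennreal \<delta>) * w z
        + ennreal (dist (fst (snd z)) (snd (snd z))) * w z \<partial>(\<pi> \<Otimes>\<^sub>M \<tau>))"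
    proof (rule nn_integral_mono)
      fix z :: "('a \<times> 'a) \<times> 'a \<times> 'a"
      show "ennreal (dist (fst (fst z)) (snd (snd z))) * w z \<le> (ennreal (dist (fst (fst z)) (snd (fst z))) + ennreal \<delta>) * w z
        + ennreal (dist (fst (snd z)) (snd (snd z))) * w z"
      \<comment> \<open>The two middle points are within \<delta> only if they share a cell;
        otherwise the density is 0 and so is the left side.\<close>
      proof (cases "i (snd (fst z)) = i (fst (snd z))")
        case True
        have "dist (fst (fst z)) (snd (snd z)) \<le> dist (fst (fst z)) (snd (fst z)) + \<delta> + dist (fst (snd z)) (snd (snd z))"
          using dist_triangle[of "fst (fst z)" "snd (snd z)" "snd (fst z)"]
            dist_triangle[of "snd (fst z)" "snd (snd z)" "fst (snd z)"] fine[OF True] by linarith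
        then have "ennreal (dist (fst (fst z)) (snd (snd z)))
            \<le> ennreal (dist (fst (fst z)) (snd (fst z))) + ennreal \<delta> + ennreal (dist (fst (snd z)) (snd (snd z)))"
          using \<delta> by (simp add: ennreal_plus[symmetric] ennreal_leI del: ennreal_plus)
        then show ?thesis by (simp add: distrib_right[symmetric] mult_right_mono)
      qed (simp add: w_def glue_weight_def)
    qed
    also have "\<dots> = (\<integral>\<^sup>+p. ennreal (dist (fst p) (snd p)) + ennreal \<delta> \<partial>\<pi>) + transport_cost \<tau>"
      unfolding transport_cost_def
      using F1[of "\<lambda>p. ennreal (dist (fst p) (snd p)) + ennreal \<delta>"] F2[of "\<lambda>p. ennreal (dist (fst p) (snd p))"]
      by (subst nn_integral_add) simp_all
    also have "\<dots> = transport_cost \<pi> + transport_cost \<tau> + ennreal \<delta>"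
      by (simp add: nn_integral_add transport_cost_def \<pi>.emeasure_space_1 ac_simps)
    finally show ?thesis .
  qed
  show ?thesis
  proof (rule ennreal_le_epsilon)
    fix e :: real assume fin: "W1 Q R + W1 R S < top" and e: "0 < e"
    \<comment> \<open>Near-optimal couplings exist only at a finite distance. Of the three thirds of
      e, two pay for near-optimality and one for the cell diameter.\<close>
    have lt: "c < c + ennreal (e / 3)" if "c < top" for c :: ennreal
      using that \<open>0 < e\<close> by (cases c) (auto simp: ennreal_plus[symmetric] ennreal_less_iff simp del: ennreal_plus)
    have "W1 Q R < W1 Q R + ennreal (e / 3)" "W1 R S < W1 R S + ennreal (e / 3)"
      using fin lt[of "W1 Q R"] lt[of "W1 R S"] by simp_all
    then obtain \<pi> \<tau> where *: "\<pi> \<in> couplings Q R" "\<tau> \<in> couplings R S"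
      "transport_cost \<pi> < W1 Q R + ennreal (e / 3)" "transport_cost \<tau> < W1 R S + ennreal (e / 3)"
      using W1_less_ex by meson
    have "W1 Q S \<le> transport_cost \<pi> + transport_cost \<tau> + ennreal (e / 3)"
      using e by (intro glue *) simp
    also have "\<dots> \<le> (W1 Q R + ennreal (e / 3)) + (W1 R S + ennreal (e / 3)) + ennreal (e / 3)"
      using * by (intro add_mono) auto
    also have "\<dots> = W1 Q R + W1 R S + (ennreal (e / 3) + ennreal (e / 3) + ennreal (e / 3))"
      by (simp add: ac_simps)
    also have "ennreal (e / 3) + ennreal (e / 3) + ennreal (e / 3) = ennreal e"
      using e by (simp add: ennreal_plus[symmetric] del: ennreal_plus)
    finally show "W1 Q S \<le> W1 Q R + W1 R S + ennreal e" .
  qed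
qed

text \<open>The elementary half of Kantorovich duality, by transport along a coupling. It concerns
  the positive part of f in \<open>ennreal\<close> and presupposes no integrability, so that it can
  also establish integrability.\<close>

lemma nn_integral_le_W1:
  fixes f :: "'a::euclidean_space \<Rightarrow> real"
  assumes f: "K-lipschitz_on UNIV f" and fin: "W1 Q R < \<infinity>"
  shows "(\<integral>\<^sup>+x. ennreal (f x) \<partial>Q) \<le> (\<integral>\<^sup>+x. ennreal (f x) \<partial>R) + ennreal K * W1 Q R"
proof -
  have K: "0 \<le> K" using f by (rule lipschitz_on_nonneg)
  have [measurable]: "f \<in> borel_measurable borel" using f by (rule borel_measurable_lipschitz)
  have *: "(\<integral>\<^sup>+x. ennreal (f x) \<partial>Q) \<le> (\<integral>\<^sup>+x. ennreal (f x) \<partial>R) + ennreal K * transport_cost \<pi>"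
    if \<pi>: "\<pi> \<in> couplings Q R" for \<pi>
  proof -
    note [measurable_cong] = couplingsD(1)[OF \<pi>]
    have "(\<integral>\<^sup>+x. ennreal (f x) \<partial>Q) = (\<integral>\<^sup>+z. ennreal (f (fst z)) \<partial>\<pi>)"
      using nn_integral_couplings(1)[OF \<pi>, of "\<lambda>x. ennreal (f x)"] by simp
    also have "\<dots> \<le> (\<integral>\<^sup>+z. ennreal (f (snd z)) + ennreal K * ennreal (dist (fst z) (snd z)) \<partial>\<pi>)"
    proof (rule nn_integral_mono)
      fix z :: "'a \<times> 'a"
      have "f (fst z) \<le> f (snd z) + K * dist (fst z) (snd z)"
        using lipschitz_onD[OF f, of "fst z" "snd z"] by (auto simp: dist_real_def)
      also have "\<dots> \<le> max 0 (f (snd z)) + K * dist (fst z) (snd z)" by simp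
      finally have "ennreal (f (fst z)) \<le> ennreal (max 0 (f (snd z)) + K * dist (fst z) (snd z))" by (rule ennreal_leI)
      also have "\<dots> = ennreal (f (snd z)) + ennreal K * ennreal (dist (fst z) (snd z))"
        using K by (subst ennreal_plus) (auto simp: ennreal_mult max_def ennreal_neg)
      finally show "ennreal (f (fst z)) \<le> ennreal (f (snd z)) + ennreal K * ennreal (dist (fst z) (snd z))" .
    qed
    also have "\<dots> = (\<integral>\<^sup>+x. ennreal (f x) \<partial>R) + ennreal K * transport_cost \<pi>"
      using nn_integral_couplings(2)[OF \<pi>, of "\<lambda>x. ennreal (f x)"]
      by (simp add: nn_integral_add nn_integral_cmult transport_cost_def)
    finally show ?thesis .
  qed
  show ?thesis
  proof (rule ennreal_le_epsilon)
    fix e :: real assume e: "0 < e"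
    \<comment> \<open>The denominator K + 1 covers K = 0.\<close>
    have "W1 Q R < W1 Q R + ennreal (e / (K + 1))"
      using e K fin by (cases "W1 Q R") (auto simp: ennreal_plus[symmetric] ennreal_less_iff simp del: ennreal_plus)
    then obtain \<pi> where \<pi>: "\<pi> \<in> couplings Q R" "transport_cost \<pi> < W1 Q R + ennreal (e / (K + 1))"
      using W1_less_ex by blast
    have eq: "ennreal (K * (e / (K + 1))) = ennreal K * ennreal (e / (K + 1))"
      using K e by (intro ennreal_mult) auto
    have "(\<integral>\<^sup>+x. ennreal (f x) \<partial>Q) \<le> (\<integral>\<^sup>+x. ennreal (f x) \<partial>R) + ennreal K * transport_cost \<pi>"
      by (rule *[OF \<pi>(1)])
    also have "\<dots> \<le> (\<integral>\<^sup>+x. ennreal (f x) \<partial>R) + ennreal K * (W1 Q R + ennreal (e / (K + 1)))"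
      using \<pi>(2) by (intro add_left_mono mult_left_mono) auto
    also have "\<dots> = (\<integral>\<^sup>+x. ennreal (f x) \<partial>R) + ennreal K * W1 Q R + ennreal (K * (e / (K + 1)))"
      unfolding eq by (simp add: distrib_left add.assoc)
    also have "\<dots> \<le> (\<integral>\<^sup>+x. ennreal (f x) \<partial>R) + ennreal K * W1 Q R + ennreal e"
      using K e by (intro add_left_mono ennreal_leI) (simp add: field_simps)
    finally show "(\<integral>\<^sup>+x. ennreal (f x) \<partial>Q) \<le> (\<integral>\<^sup>+x. ennreal (f x) \<partial>R) + ennreal K * W1 Q R + ennreal e" .
  qed
qed

section \<open>An envelope theorem\<close>

text \<open>Testing with y0 bounds the quotient from above. For the lower bound take y attaining V
  \<epsilon>: close to [a, b], I can fall below I y0 by at most e / 2; far away, the growth of G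
  outweighs the possible decrease of \<epsilon> I. No convergence of the perturbed minimizers is
  used.\<close>

lemma danskin_right_derivative:
  fixes G I V :: "real \<Rightarrow> real"
  assumes ab: "a \<le> b"
    and growth: "\<And>\<delta>. 0 < \<delta> \<Longrightarrow> \<exists>s>0. (\<forall>y\<ge>b + \<delta>. C + s * (y - b) \<le> G y) \<and> (\<forall>y\<le>a - \<delta>. C + s * (a - y) \<le> G y)"
    and lower: "\<And>y. C \<le> G y"
    and lip: "0 \<le> K" "\<And>y z. \<bar>I y - I z\<bar> \<le> K * \<bar>y - z\<bar>"
    and y0: "G y0 = C" "\<And>y. y \<in> {a..b} \<Longrightarrow> I y0 \<le> I y"
    and V: "\<forall>\<^sub>F \<epsilon> in at_right 0. (\<forall>y. V \<epsilon> \<le> G y + \<epsilon> * I y) \<and> (\<exists>y. V \<epsilon> = G y + \<epsilon> * I y)"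
  shows "((\<lambda>\<epsilon>. (V \<epsilon> - C) / \<epsilon>) \<longlongrightarrow> I y0) (at_right 0)"
proof (rule tendstoI)
  fix e :: real assume e: "0 < e"
  define \<delta> where "\<delta> = e / (2 * (K + 1))"
  have \<delta>: "0 < \<delta>" "K * \<delta> \<le> e / 2" using e lip(1) by (auto simp: \<delta>_def field_simps)
  obtain s where s: "0 < s" "\<And>y. b + \<delta> \<le> y \<Longrightarrow> C + s * (y - b) \<le> G y" "\<And>y. y \<le> a - \<delta> \<Longrightarrow> C + s * (a - y) \<le> G y"
    using growth[OF \<delta>(1)] by blast
  have near: "G y + \<epsilon> * I y \<ge> C + \<epsilon> * (I y0 - e / 2)" if \<epsilon>: "0 < \<epsilon>" "\<epsilon> * K \<le> s" for \<epsilon> y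
  proof -
    \<comment> \<open>The projection of y onto [a, b], where I is at least I y0.\<close>
    define p where "p = max a (min b y)"
    have p: "p \<in> {a..b}" using ab by (auto simp: p_def)
    have Ip: "I y0 - K * \<bar>y - p\<bar> \<le> I y" using y0(2)[OF p] lip(2)[of y p] by linarith
    have "C - \<epsilon> * (e / 2) \<le> G y - \<epsilon> * (K * \<bar>y - p\<bar>)"
    proof (cases "\<bar>y - p\<bar> \<le> \<delta>")
      case True
      have "K * \<bar>y - p\<bar> \<le> K * \<delta>" using True lip(1) by (rule mult_left_mono)
      then have "\<epsilon> * (K * \<bar>y - p\<bar>) \<le> \<epsilon> * (e / 2)" using \<delta>(2) \<epsilon>(1) by (intro mult_left_mono) auto
      then show ?thesis using lower[of y] by linarith
    next
      case False
      then have "(b + \<delta> \<le> y \<and> \<bar>y - p\<bar> = y - b) \<or> (y \<le> a - \<delta> \<and> \<bar>y - p\<bar> = a - y)"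
        using ab \<delta>(1) by (auto simp: p_def max_def min_def split: if_splits)
      then have "C + s * \<bar>y - p\<bar> \<le> G y" using s(2,3)[of y] by auto
      moreover have "\<epsilon> * K * \<bar>y - p\<bar> \<le> s * \<bar>y - p\<bar>" using \<epsilon> by (intro mult_right_mono) auto
      moreover have "0 \<le> \<epsilon> * (e / 2)" using e \<epsilon> by simp
      ultimately show ?thesis by (simp add: mult.assoc)
    qed
    moreover have "\<epsilon> * (I y0 - K * \<bar>y - p\<bar>) \<le> \<epsilon> * I y" using Ip \<epsilon>(1) by (intro mult_left_mono) auto
    ultimately show ?thesis by (simp add: algebra_simps)
  qed
  \<comment> \<open>Below s / (K + 1) one has \<epsilon> K \<le> s, so the growth rate beats the
    Lipschitz constant of \<epsilon> I.\<close>
  have "\<forall>\<^sub>F \<epsilon> in at_right 0. \<epsilon> \<in> {0<..<s / (K + 1)}"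
    using s(1) lip(1) by (intro eventually_at_right_real) simp
  with V show "\<forall>\<^sub>F \<epsilon> in at_right 0. dist ((V \<epsilon> - C) / \<epsilon>) (I y0) < e"
  proof eventually_elim
    case (elim \<epsilon>)
    then have \<epsilon>: "0 < \<epsilon>" and "\<epsilon> * (K + 1) < s" using lip(1) by (auto simp: pos_less_divide_eq)
    then have \<epsilon>2: "\<epsilon> * K \<le> s" by (simp add: distrib_left)
    from elim obtain y where "V \<epsilon> = G y + \<epsilon> * I y" by blast
    then have 1: "\<epsilon> * (I y0 - e / 2) \<le> V \<epsilon> - C" using near[OF \<epsilon> \<epsilon>2, of y] by simp
    have 2: "V \<epsilon> - C \<le> \<epsilon> * I y0" using elim y0(1) by (metis add_diff_cancel_left' diff_right_mono)
    have "I y0 - e / 2 \<le> (V \<epsilon> - C) / \<epsilon>" "(V \<epsilon> - C) / \<epsilon> \<le> I y0"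
      using 1 2 \<epsilon> by (simp_all add: pos_le_divide_eq pos_divide_le_eq mult.commute)
    then show ?case using e by (simp add: dist_real_def)
  qed
qed

section \<open>Lipschitz continuity in the Wasserstein distance\<close>

lemma cvar_spaceI:
  assumes "R \<in> borel_probs" "\<And>x. 0 \<le> g x" "integrable R g" "0 < \<alpha>" "\<alpha> < 1"
  shows "cvar_space R g \<alpha>"
  using assms by (auto simp: cvar_space_def cvar_space_axioms_def borel_probs_iff)

text \<open>With s = t / t0, Q + t \<rho> is the mixture of Q with weight 1 - s and Q + t0 \<rho>
  with weight s. Leaving a point in place with probability 1 - s and redrawing it independently
  otherwise costs at most s times the sum of the two first moments.\<close>

lemma W1_perturb_le:
  fixes Q :: "'a::euclidean_space measure"
  assumes Q: "Q \<in> borel_probs" and \<rho>: "signed_measure \<rho>"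
    and p0: "perturb_prob Q t0 \<rho>" and p: "perturb_prob Q t \<rho>" and t: "0 \<le> t" "t \<le> t0" "0 < t0"
  shows "W1 (perturb Q t \<rho>) Q
    \<le> ((\<integral>\<^sup>+x. norm x \<partial>Q) + (\<integral>\<^sup>+x. norm x \<partial>perturb Q t0 \<rho>)) * ennreal (t / t0)"
proof -
  define s where "s = t / t0"
  have s: "0 \<le> s" "s \<le> 1" using t by (auto simp: s_def)
  let ?R = "perturb Q t \<rho>"
  define R0 where "R0 = perturb Q t0 \<rho>"
  have R: "?R \<in> borel_probs" "R0 \<in> borel_probs" using p p0 by (auto simp: perturb_prob_def R0_def)
  have sets[measurable_cong]: "sets Q = sets borel" "sets R0 = sets borel" and "prob_space Q" "prob_space R0" "prob_space ?R"
    using Q R by (auto simp: borel_probs_iff)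
  interpret Q: prob_space Q by fact
  interpret R0: prob_space R0 by fact
  interpret R: prob_space ?R by fact
  interpret QR: pair_prob_space Q R0 ..
  let ?B = "measure_pmf (bernoulli_pmf s)"
  interpret B: prob_space ?B by (rule prob_space_measure_pmf)
  \<comment> \<open>The coin \<open>fst z\<close> decides whether the point is redrawn; the second
    component of the image keeps the original point.\<close>
  define \<pi> where "\<pi> = distr (?B \<Otimes>\<^sub>M (Q \<Otimes>\<^sub>M R0)) (borel \<Otimes>\<^sub>M borel)
    (\<lambda>z. (if fst z then snd (snd z) else fst (snd z), fst (snd z)))"
  have F: "(\<integral>\<^sup>+z. f z \<partial>\<pi>) = (\<integral>\<^sup>+x. \<integral>\<^sup>+y. f (y, x) \<partial>R0 \<partial>Q) * ennreal s + (\<integral>\<^sup>+x. f (x, x) \<partial>Q) * ennreal (1 - s)"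
    if [measurable]: "f \<in> borel_measurable (borel \<Otimes>\<^sub>M borel)" for f
  proof -
    have [measurable]: "(\<lambda>z. (if fst z then snd (snd z) else fst (snd z), fst (snd z)))
        \<in> measurable (?B \<Otimes>\<^sub>M (Q \<Otimes>\<^sub>M R0)) (borel \<Otimes>\<^sub>M borel)"
      by measurable
    have "(\<integral>\<^sup>+z. f z \<partial>\<pi>) = (\<integral>\<^sup>+b. \<integral>\<^sup>+w. f (if b then snd w else fst w, fst w) \<partial>(Q \<Otimes>\<^sub>M R0) \<partial>?B)"
      unfolding \<pi>_def by (subst nn_integral_distr) (simp_all add: QR.nn_integral_fst[symmetric] cong: if_cong)
    also have "\<dots> = (\<integral>\<^sup>+w. f (snd w, fst w) \<partial>(Q \<Otimes>\<^sub>M R0)) * ennreal s + (\<integral>\<^sup>+w. f (fst w, fst w) \<partial>(Q \<Otimes>\<^sub>M R0)) * ennreal (1 - s)"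
      using s by simp
    also have "(\<integral>\<^sup>+w. f (snd w, fst w) \<partial>(Q \<Otimes>\<^sub>M R0)) = (\<integral>\<^sup>+x. \<integral>\<^sup>+y. f (y, x) \<partial>R0 \<partial>Q)"
      by (subst R0.nn_integral_fst[symmetric]) simp_all
    also have "(\<integral>\<^sup>+w. f (fst w, fst w) \<partial>(Q \<Otimes>\<^sub>M R0)) = (\<integral>\<^sup>+x. f (x, x) \<partial>Q)"
      by (subst R0.nn_integral_fst[symmetric]) (simp_all add: R0.emeasure_space_1)
    finally show ?thesis .
  qed
  have "\<pi> \<in> couplings ?R Q"
  proof (rule couplingsI[OF _ R(1) Q])
    show "sets \<pi> = sets (borel \<Otimes>\<^sub>M borel)" by (simp add: \<pi>_def)
  next
    fix A :: "'a set" assume A[measurable]: "A \<in> sets borel"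
    have "measure R0 A * s + measure Q A * (1 - s) = measure ?R A"
      using t by (simp add: R0_def measure_perturb[OF Q \<rho> p0 A] measure_perturb[OF Q \<rho> p A] s_def field_simps)
    then show "(\<integral>\<^sup>+z. indicator A (fst z) \<partial>\<pi>) = emeasure ?R A"
      using s by (simp add: F Q.emeasure_space_1 sets Q.emeasure_eq_measure R0.emeasure_eq_measure R.emeasure_eq_measure
          Q.prob_space ennreal_mult[symmetric] ennreal_plus[symmetric] del: ennreal_plus)
    show "(\<integral>\<^sup>+z. indicator A (snd z) \<partial>\<pi>) = emeasure Q A"
      using s by (simp add: F R0.emeasure_space_1 sets distrib_left[symmetric] ennreal_plus[symmetric] del: ennreal_plus)
  qed
  then have "W1 ?R Q \<le> transport_cost \<pi>" by (rule W1_le)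
  also have "\<dots> = (\<integral>\<^sup>+x. \<integral>\<^sup>+y. ennreal (dist y x) \<partial>R0 \<partial>Q) * ennreal s"
    by (simp add: transport_cost_def F)
  also have "(\<integral>\<^sup>+x. \<integral>\<^sup>+y. ennreal (dist y x) \<partial>R0 \<partial>Q) \<le> (\<integral>\<^sup>+x. \<integral>\<^sup>+y. ennreal (norm x) + ennreal (norm y) \<partial>R0 \<partial>Q)"
    by (intro nn_integral_mono) (simp add: dist_norm ennreal_plus[symmetric] ennreal_leI norm_triangle_le_diff
        order_trans[OF norm_triangle_ineq4] add.commute del: ennreal_plus)
  also have "\<dots> = (\<integral>\<^sup>+x. norm x \<partial>Q) + (\<integral>\<^sup>+x. norm x \<partial>R0)"
    by (simp add: nn_integral_add R0.emeasure_space_1 Q.emeasure_space_1)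
  finally show ?thesis by (simp add: s_def R0_def mult_right_mono)
qed

text \<open>Backward perturbations are competitors in the Clarke limsup only if they approach Q in
  W1; this is applied to -\<rho>.\<close>

lemma eventually_W1_perturb_less:
  fixes Q :: "'a::euclidean_space measure"
  assumes Q: "Q \<in> borel_probs" "finite_first_moment Q" and \<rho>: "right_admissible Q \<rho>" and r: "0 < r"
  shows "\<forall>\<^sub>F t in at_right 0. W1 (perturb Q t \<rho>) Q < ennreal r"
proof -
  obtain t0 where t0: "0 < t0" "perturb_prob Q t0 \<rho>" using right_admissible_ex[OF \<rho>] by blast
  have s: "signed_measure \<rho>" and ev: "\<forall>\<^sub>F t in at_right 0. perturb_prob Q t \<rho>"
    using \<rho> by (auto simp: right_admissible_def)
  define c where "c = (\<integral>\<^sup>+x. norm x \<partial>Q) + (\<integral>\<^sup>+x. norm x \<partial>perturb Q t0 \<rho>)"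
  have "c < \<infinity>"
    using Q(2) finite_first_moment_perturb[OF Q \<rho> t0(2,1)]
    by (simp add: c_def finite_first_moment_def integrable_iff_bounded)
  then obtain C where C: "c = ennreal C" "0 \<le> C" by (cases c) auto
  have "\<forall>\<^sub>F t in at_right 0. t \<in> {0<..<min t0 (r * t0 / (C + 1))}"
    using t0 r C by (intro eventually_at_right_real) simp
  with ev show ?thesis
  proof eventually_elim
    case (elim t)
    then have t: "0 < t" "t \<le> t0" "t < r * t0 / (C + 1)" by auto
    have "W1 (perturb Q t \<rho>) Q \<le> c * ennreal (t / t0)"
      unfolding c_def using t t0 elim by (intro W1_perturb_le[OF Q(1) s]) auto
    also have "\<dots> = ennreal (C * (t / t0))" unfolding C(1) by (intro ennreal_mult[symmetric]) (use C t t0 in auto)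
    also have "\<dots> < ennreal r"
    proof (rule ennreal_lessI[OF r])
      have "C * (t / t0) \<le> (C + 1) * (t / t0)" using t t0 by (intro mult_right_mono) auto
      also have "\<dots> < r" using t t0 C by (simp add: field_simps)
      finally show "C * (t / t0) < r" .
    qed
    finally show ?case .
  qed
qed

section \<open>Lipschitz bounds for the divergence, CVaR and the functional\<close>

text \<open>The divergence is an infimal convolution with L times W1, so the triangle inequality for
  each \<gamma> passes to the infimum.\<close>

lemma DKL_Lip_le:
  assumes Q: "Q1 \<in> borel_probs" and fin: "W1 Q1 Q2 < \<infinity>"
  shows "DKL_Lip L Q1 P \<le> DKL_Lip L Q2 P + ennreal L * W1 Q1 Q2"
proof -
  have nt: "ennreal L * W1 Q1 Q2 \<noteq> top" using fin by (auto simp: ennreal_mult_eq_top_iff)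
  \<comment> \<open>The transport term is moved to the left to leave a bare infimum on the right;
    its finiteness makes truncated subtraction reversible.\<close>
  have "DKL_Lip L Q1 P - ennreal L * W1 Q1 Q2 \<le> DKL_Lip L Q2 P"
    unfolding DKL_Lip_def[of L Q2]
  proof (rule INF_greatest)
    fix \<gamma> :: "'a measure" assume \<gamma>: "\<gamma> \<in> borel_probs"
    have "DKL_Lip L Q1 P \<le> KL \<gamma> P + ennreal L * W1 Q1 \<gamma>"
      unfolding DKL_Lip_def by (rule INF_lower[OF \<gamma>])
    also have "\<dots> \<le> KL \<gamma> P + ennreal L * (W1 Q1 Q2 + W1 Q2 \<gamma>)"
      by (intro add_left_mono mult_left_mono W1_triangle Q \<gamma>) simp
    finally show "DKL_Lip L Q1 P - ennreal L * W1 Q1 Q2 \<le> KL \<gamma> P + ennreal L * W1 Q2 \<gamma>"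
      using nt by (simp add: ennreal_minus_le_iff distrib_left ac_simps)
  qed
  then show ?thesis using nt by (simp add: ennreal_minus_le_iff add.commute)
qed

text \<open>At finite distance the two divergences are both finite or both infinite, and in the
  latter case both are coerced to 0.\<close>

lemma DKL_Lip_real_lipschitz:
  assumes Q: "Q1 \<in> borel_probs" "Q2 \<in> borel_probs" and fin: "W1 Q1 Q2 < \<infinity>" and L: "0 \<le> L"
  shows "\<bar>DKL_Lip_real L P Q1 - DKL_Lip_real L P Q2\<bar> \<le> L * enn2real (W1 Q1 Q2)"
proof -
  obtain w where w: "W1 Q1 Q2 = ennreal w" "0 \<le> w" using fin by (cases "W1 Q1 Q2") auto
  have *: "DKL_Lip L Q1 P \<le> DKL_Lip L Q2 P + ennreal (L * w)" "DKL_Lip L Q2 P \<le> DKL_Lip L Q1 P + ennreal (L * w)"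
    using DKL_Lip_le[OF Q(1) fin, of L P] DKL_Lip_le[OF Q(2), of Q1 L P] fin w L
    by (simp_all add: W1_commute[of Q2] ennreal_mult)
  have "0 \<le> L * w" using L w by simp
  with * show ?thesis
    unfolding DKL_Lip_real_def w(1) using w(2)
    by (cases "DKL_Lip L Q1 P"; cases "DKL_Lip L Q2 P")
      (auto simp: ennreal_plus[symmetric] top_unique simp del: ennreal_plus)
qed

lemma lipschitz_h_fun:
  assumes g: "K-lipschitz_on UNIV g" and \<alpha>: "\<alpha> < 1"
  shows "(K / (1 - \<alpha>))-lipschitz_on UNIV (h_fun \<alpha> g y)"
proof (rule lipschitz_onI)
  fix x z
  have "dist (h_fun \<alpha> g y x) (h_fun \<alpha> g y z) = \<bar>max 0 (g x - y) - max 0 (g z - y)\<bar> / (1 - \<alpha>)"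
    using \<alpha> by (simp add: h_fun_def dist_real_def diff_divide_distrib[symmetric])
  also have "\<dots> \<le> K * dist x z / (1 - \<alpha>)"
    using lipschitz_onD[OF g, of x z] \<alpha> by (intro divide_right_mono) (auto simp: dist_real_def)
  finally show "dist (h_fun \<alpha> g y x) (h_fun \<alpha> g y z) \<le> K / (1 - \<alpha>) * dist x z" by simp
qed (use lipschitz_on_nonneg[OF g] \<alpha> in simp)

text \<open>Local Lipschitz continuity quantifies over all measures close to Q, so integrability of
  g under them has to be derived from that under Q.\<close>

lemma integrable_W1:
  fixes g :: "'a::euclidean_space \<Rightarrow> real"
  assumes g: "K-lipschitz_on UNIV g" "\<And>x. 0 \<le> g x" and R: "R1 \<in> borel_probs"
    and i: "integrable R2 g" and fin: "W1 R1 R2 < \<infinity>"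
  shows "integrable R1 g"
proof -
  have [measurable_cong]: "sets R1 = sets borel" using R by (simp add: borel_probs_iff)
  have [measurable]: "g \<in> borel_measurable borel" using g(1) by (rule borel_measurable_lipschitz)
  have "(\<integral>\<^sup>+x. ennreal (g x) \<partial>R1) \<le> (\<integral>\<^sup>+x. ennreal (g x) \<partial>R2) + ennreal K * W1 R1 R2"
    by (rule nn_integral_le_W1[OF g(1) fin])
  also have "\<dots> < \<infinity>"
    using i fin g(2) by (auto simp: integrable_iff_bounded ennreal_mult_less_top)
  finally show ?thesis using g(2) by (simp add: integrable_iff_bounded)
qed

text \<open>Evaluate the objective of one measure at the minimizer of the other: every
  \<open>h_fun \<alpha> g y\<close> has the same Lipschitz constant K / (1 - \<alpha>), whatever y
  is.\<close>

lemma CVaR_lipschitz: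
  assumes g: "K-lipschitz_on UNIV g" "\<And>x. 0 \<le> g x" and \<alpha>: "0 < \<alpha>" "\<alpha> < 1"
    and R: "R1 \<in> borel_probs" "R2 \<in> borel_probs" and i: "integrable R1 g" "integrable R2 g"
    and fin: "W1 R1 R2 < \<infinity>"
  shows "\<bar>CVaR \<alpha> R1 g - CVaR \<alpha> R2 g\<bar> \<le> K / (1 - \<alpha>) * enn2real (W1 R1 R2)"
proof -
  have *: "CVaR \<alpha> R1 g \<le> CVaR \<alpha> R2 g + K / (1 - \<alpha>) * enn2real (W1 R1 R2)"
    if R: "R1 \<in> borel_probs" "R2 \<in> borel_probs" and i: "integrable R1 g" "integrable R2 g" and fin: "W1 R1 R2 < \<infinity>"
    for R1 R2
  proof -
    interpret R1: cvar_space R1 g \<alpha> by (rule cvar_spaceI) fact+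
    interpret R2: cvar_space R2 g \<alpha> by (rule cvar_spaceI) fact+
    define y where "y = VaR \<alpha> R2 g"
    obtain w where w: "W1 R1 R2 = ennreal w" "0 \<le> w" using fin by (cases "W1 R1 R2") auto
    have K: "0 \<le> K / (1 - \<alpha>)" using lipschitz_on_nonneg[OF g(1)] \<alpha> by simp
    have h0: "0 \<le> h_fun \<alpha> g y x" for x using \<alpha> by (simp add: h_fun_def)
    have "ennreal (\<integral>x. h_fun \<alpha> g y x \<partial>R1) = (\<integral>\<^sup>+x. ennreal (h_fun \<alpha> g y x) \<partial>R1)"
      by (intro nn_integral_eq_integral[symmetric] R1.h_fun_integrable) (simp add: h0)
    also have "\<dots> \<le> (\<integral>\<^sup>+x. ennreal (h_fun \<alpha> g y x) \<partial>R2) + ennreal (K / (1 - \<alpha>)) * W1 R1 R2"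
      by (rule nn_integral_le_W1[OF lipschitz_h_fun[OF g(1) \<alpha>(2)] fin])
    also have "(\<integral>\<^sup>+x. ennreal (h_fun \<alpha> g y x) \<partial>R2) = ennreal (\<integral>x. h_fun \<alpha> g y x \<partial>R2)"
      by (intro nn_integral_eq_integral R2.h_fun_integrable) (simp add: h0)
    also have "\<dots> + ennreal (K / (1 - \<alpha>)) * W1 R1 R2 = ennreal ((\<integral>x. h_fun \<alpha> g y x \<partial>R2) + K / (1 - \<alpha>) * w)"
      unfolding w(1) using w(2) K h0 by (simp only: ennreal_mult ennreal_plus mult_nonneg_nonneg Bochner_Integration.integral_nonneg)
    finally have "(\<integral>x. h_fun \<alpha> g y x \<partial>R1) \<le> (\<integral>x. h_fun \<alpha> g y x \<partial>R2) + K / (1 - \<alpha>) * w"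
      using w(2) K h0 by (subst (asm) ennreal_le_iff) (simp_all only: add_nonneg_nonneg mult_nonneg_nonneg Bochner_Integration.integral_nonneg)
    then have "ru_objective \<alpha> g R1 y \<le> CVaR \<alpha> R2 g + K / (1 - \<alpha>) * w"
      by (simp add: R2.CVaR_eq_ru_VaR ru_objective_def y_def)
    then show ?thesis using R1.CVaR_le_ru[of y] w by simp
  qed
  show ?thesis
    using *[OF R i fin] *[OF R(2,1) i(2,1)] fin by (simp add: W1_commute[of R2])
qed

text \<open>The square is only locally Lipschitz. On the unit W1-ball the gap exceeds its absolute
  value at Q by at most K', so B bounds the sum of two gaps, and a^2 - b^2 = (a + b)(a - b) gives
  the constant M.\<close>

lemma F_CVaR_locally_Lipschitz:
  fixes Q :: "'a::euclidean_space measure"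
  assumes g: "K-lipschitz_on UNIV g" "\<And>x. 0 \<le> g x" and \<alpha>: "0 < \<alpha>" "\<alpha> < 1" and lam: "0 < lam" and L: "0 < L"
    and Q: "Q \<in> borel_probs" "integrable Q g"
  shows "locally_Lipschitz_W1 (F_CVaR L lam \<alpha> g P) Q"
proof -
  define K' where "K' = K / (1 - \<alpha>)"
  define B where "B = 2 * (\<bar>Delta_C \<alpha> g P Q\<bar> + K')"
  define M where "M = L + lam * (B * K')"
  have K': "0 \<le> K'" using lipschitz_on_nonneg[OF g(1)] \<alpha> by (simp add: K'_def)
  have B: "0 \<le> B" using K' by (simp add: B_def)
  have M: "0 < M" using L lam B K' by (simp add: M_def add_pos_nonneg)
  have *: "ennreal \<bar>F_CVaR L lam \<alpha> g P Q1 - F_CVaR L lam \<alpha> g P Q2\<bar> \<le> ennreal M * W1 Q1 Q2"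
    if Q1: "Q1 \<in> borel_probs" "W1 Q1 Q < ennreal 1" and Q2: "Q2 \<in> borel_probs" "W1 Q2 Q < ennreal 1" for Q1 Q2
  proof -
    have fin1: "W1 Q1 Q < \<infinity>" "W1 Q2 Q < \<infinity>" using Q1 Q2 by (auto intro: order.strict_trans)
    have "W1 Q1 Q2 \<le> W1 Q1 Q + W1 Q Q2" by (rule W1_triangle) fact+
    also have "\<dots> < \<infinity>" using fin1 by (simp add: W1_commute[of Q])
    finally have fin: "W1 Q1 Q2 < \<infinity>" .
    then obtain w where w: "W1 Q1 Q2 = ennreal w" "0 \<le> w" by (cases "W1 Q1 Q2") auto
    have i: "integrable Q1 g" "integrable Q2 g"
      using integrable_W1[OF g _ Q(2)] Q1 Q2 fin1 by auto
    have near: "\<bar>Delta_C \<alpha> g P R\<bar> \<le> B / 2" if "R \<in> borel_probs" "integrable R g" "W1 R Q < ennreal 1" for R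
    proof -
      have f: "W1 R Q < \<infinity>" using that(3) by (auto intro: order.strict_trans)
      have "enn2real (W1 R Q) \<le> 1" using that(3) f by (cases "W1 R Q") (auto simp: ennreal_less_iff)
      then have "K' * enn2real (W1 R Q) \<le> K' * 1" using K' by (intro mult_left_mono) auto
      then have "\<bar>Delta_C \<alpha> g P R\<bar> \<le> \<bar>Delta_C \<alpha> g P Q\<bar> + K'"
        using CVaR_lipschitz[OF g \<alpha> that(1) Q(1) that(2) Q(2) f]
        unfolding K'_def[symmetric] Delta_C_def by linarith
      then show ?thesis by (simp add: B_def)
    qed
    have D: "\<bar>DKL_Lip_real L P Q1 - DKL_Lip_real L P Q2\<bar> \<le> L * w"
      using DKL_Lip_real_lipschitz[OF Q1(1) Q2(1) fin, of L P] L w by simp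
    have C: "\<bar>Delta_C \<alpha> g P Q1 - Delta_C \<alpha> g P Q2\<bar> \<le> K' * w"
      using CVaR_lipschitz[OF g \<alpha> Q1(1) Q2(1) i fin] w by (auto simp: Delta_C_def K'_def)
    have S: "\<bar>Delta_C \<alpha> g P Q1 + Delta_C \<alpha> g P Q2\<bar> \<le> B"
      using near[OF Q1(1) i(1) Q1(2)] near[OF Q2(1) i(2) Q2(2)] by linarith
    have "\<bar>(Delta_C \<alpha> g P Q1)\<^sup>2 - (Delta_C \<alpha> g P Q2)\<^sup>2\<bar>
        = \<bar>Delta_C \<alpha> g P Q1 + Delta_C \<alpha> g P Q2\<bar> * \<bar>Delta_C \<alpha> g P Q1 - Delta_C \<alpha> g P Q2\<bar>"
      by (simp add: abs_mult[symmetric] power2_eq_square algebra_simps)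
    also have "\<dots> \<le> B * (K' * w)" using S C B by (intro mult_mono) auto
    finally have "lam * \<bar>(Delta_C \<alpha> g P Q1)\<^sup>2 - (Delta_C \<alpha> g P Q2)\<^sup>2\<bar> \<le> lam * (B * (K' * w))"
      using lam by (intro mult_left_mono) auto
    then have "\<bar>lam * (Delta_C \<alpha> g P Q1)\<^sup>2 - lam * (Delta_C \<alpha> g P Q2)\<^sup>2\<bar> \<le> lam * (B * (K' * w))"
      using lam by (simp add: abs_mult right_diff_distrib[symmetric])
    then have "\<bar>F_CVaR L lam \<alpha> g P Q1 - F_CVaR L lam \<alpha> g P Q2\<bar> \<le> M * w"
      using D unfolding F_CVaR_def M_def by (simp add: distrib_right)
    then show ?thesis using M w by (simp add: ennreal_mult[symmetric] ennreal_leI)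
  qed
  show ?thesis
    unfolding locally_Lipschitz_W1_def
    by (rule exI[of _ 1], rule conjI, simp, rule exI[of _ M]) (use M * in auto)
qed

section \<open>Directional derivatives\<close>

text \<open>Left derivatives are reduced to right ones along -\<rho>, which turns the minimum over
  T(Q) into a maximum.\<close>

lemma has_left_derivative_uminus:
  "has_left_derivative J Q \<rho> D \<longleftrightarrow> has_right_derivative J Q (\<lambda>A. - \<rho> A) (- D)"
proof -
  have "diff_quotient J Q (\<lambda>A. - \<rho> A) = (\<lambda>\<epsilon>. - diff_quotient J Q \<rho> (- \<epsilon>))"
    by (simp add: diff_quotient_def perturb_uminus fun_eq_iff)
  then have "has_right_derivative J Q (\<lambda>A. - \<rho> A) (- D) \<longleftrightarrow> ((\<lambda>\<epsilon>. - diff_quotient J Q \<rho> (- \<epsilon>)) \<longlongrightarrow> - D) (at_right 0)"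
    by (simp add: has_right_derivative_def)
  also have "\<dots> \<longleftrightarrow> ((\<lambda>\<epsilon>. diff_quotient J Q \<rho> (- \<epsilon>)) \<longlongrightarrow> D) (at_right 0)"
    by (simp add: tendsto_minus_cancel_left)
  also have "\<dots> \<longleftrightarrow> has_left_derivative J Q \<rho> D"
    by (simp add: has_left_derivative_def filterlim_at_left_to_right)
  finally show ?thesis by simp
qed

lemma
  fixes g :: "'a::euclidean_space \<Rightarrow> real"
  assumes g: "K-lipschitz_on UNIV g" "\<And>x. 0 \<le> g x" and \<alpha>: "0 < \<alpha>" "\<alpha> < 1"
    and Q: "Q \<in> borel_probs" "finite_first_moment Q" and \<rho>: "right_admissible Q \<rho>"
  shows continuous_on_signed_integral_h_fun:
      "continuous_on UNIV (\<lambda>y. signed_integral \<rho> (h_fun \<alpha> g y))" (is ?cont)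
    and CVaR_has_right_derivative:
      "\<And>y0. y0 \<in> T_set \<alpha> Q g \<Longrightarrow>
        (\<And>y. y \<in> T_set \<alpha> Q g \<Longrightarrow> signed_integral \<rho> (h_fun \<alpha> g y0) \<le> signed_integral \<rho> (h_fun \<alpha> g y)) \<Longrightarrow>
        has_right_derivative (\<lambda>R. CVaR \<alpha> R g) Q \<rho> (signed_integral \<rho> (h_fun \<alpha> g y0))"
proof -
  define I where "I y = signed_integral \<rho> (h_fun \<alpha> g y)" for y
  have s: "signed_measure \<rho>" and ev: "\<forall>\<^sub>F t in at_right 0. perturb_prob Q t \<rho>"
    using \<rho> by (auto simp: right_admissible_def)
  interpret Q: cvar_space Q g \<alpha>
    by (rule cvar_spaceI) (use integrable_lipschitz g Q \<alpha> in auto)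
  have cv: "cvar_space (perturb Q \<epsilon> \<rho>) g \<alpha>" if "0 < \<epsilon>" "perturb_prob Q \<epsilon> \<rho>" for \<epsilon>
    using that finite_first_moment_perturb[OF Q \<rho> that(2,1)]
    by (intro cvar_spaceI) (use integrable_lipschitz[OF g(1)] g \<alpha> in \<open>auto simp: perturb_prob_def\<close>)
  have ru: "ru_objective \<alpha> g (perturb Q \<epsilon> \<rho>) y = ru_objective \<alpha> g Q y + \<epsilon> * I y"
    if "0 < \<epsilon>" "perturb_prob Q \<epsilon> \<rho>" for \<epsilon> y
    using integral_perturb[OF Q(1) s that(2,1) Q.h_fun_integrable cvar_space.h_fun_integrable[OF cv[OF that]], of y]
    by (simp add: ru_objective_def I_def)
  obtain t where t: "0 < t" "perturb_prob Q t \<rho>" using right_admissible_ex[OF \<rho>] by blast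
  interpret R: cvar_space "perturb Q t \<rho>" g \<alpha> using cv[OF t] .
  define M where "M = 2 / (1 - \<alpha>) / t"
  have M: "0 \<le> M" using \<alpha> t by (simp add: M_def)
  have lip: "\<bar>I y - I z\<bar> \<le> M * \<bar>y - z\<bar>" for y z
  proof -
    \<comment> \<open>By affinity, t I is the difference of the objectives of Q + t \<rho> and Q,
      each Lipschitz with constant 1 / (1 - \<alpha>); this is the origin of M.\<close>
    have "t * (I y - I z) = (ru_objective \<alpha> g (perturb Q t \<rho>) y - ru_objective \<alpha> g (perturb Q t \<rho>) z)
        - (ru_objective \<alpha> g Q y - ru_objective \<alpha> g Q z)"
      using ru[OF t] by (simp add: algebra_simps)
    then have "\<bar>t * (I y - I z)\<bar> \<le> 1 / (1 - \<alpha>) * \<bar>y - z\<bar> + 1 / (1 - \<alpha>) * \<bar>y - z\<bar>"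
      using R.ru_lipschitz[of y z] Q.ru_lipschitz[of y z] by linarith
    then have "t * \<bar>I y - I z\<bar> \<le> 2 / (1 - \<alpha>) * \<bar>y - z\<bar>"
      using t by (simp add: abs_mult)
    then have "\<bar>I y - I z\<bar> \<le> 2 / (1 - \<alpha>) * \<bar>y - z\<bar> / t"
      using t by (subst pos_le_divide_eq) (simp_all only: mult.commute[of _ t])
    then show ?thesis by (simp add: M_def)
  qed
  show ?cont
    unfolding I_def[symmetric] using lip M
    by (intro lipschitz_on_continuous_on[of M] lipschitz_onI) (auto simp: dist_real_def)
  fix y0 assume y0: "y0 \<in> T_set \<alpha> Q g"
    "\<And>y. y \<in> T_set \<alpha> Q g \<Longrightarrow> signed_integral \<rho> (h_fun \<alpha> g y0) \<le> signed_integral \<rho> (h_fun \<alpha> g y)"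
  have "((\<lambda>\<epsilon>. (CVaR \<alpha> (perturb Q \<epsilon> \<rho>) g - CVaR \<alpha> Q g) / \<epsilon>) \<longlongrightarrow> I y0) (at_right 0)"
  proof (rule danskin_right_derivative[where G="ru_objective \<alpha> g Q", OF Q.VaR_le_upper _ Q.CVaR_le_ru M lip])
    fix \<delta> :: real assume "0 < \<delta>"
    then show "\<exists>s>0. (\<forall>y\<ge>VaR_upper \<alpha> Q g + \<delta>. CVaR \<alpha> Q g + s * (y - VaR_upper \<alpha> Q g) \<le> ru_objective \<alpha> g Q y) \<and>
        (\<forall>y\<le>VaR \<alpha> Q g - \<delta>. CVaR \<alpha> Q g + s * (VaR \<alpha> Q g - y) \<le> ru_objective \<alpha> g Q y)"
      by (metis Q.ru_growth)
  next
    show "ru_objective \<alpha> g Q y0 = CVaR \<alpha> Q g" using Q.CVaR_eq_ru[OF y0(1)] by simp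
    show "I y0 \<le> I y" if "y \<in> {VaR \<alpha> Q g..VaR_upper \<alpha> Q g}" for y
      using y0(2) that by (simp add: I_def T_set_def)
    show "\<forall>\<^sub>F \<epsilon> in at_right 0. (\<forall>y. CVaR \<alpha> (perturb Q \<epsilon> \<rho>) g \<le> ru_objective \<alpha> g Q y + \<epsilon> * I y) \<and>
        (\<exists>y. CVaR \<alpha> (perturb Q \<epsilon> \<rho>) g = ru_objective \<alpha> g Q y + \<epsilon> * I y)"
      using ev eventually_at_right_less[of "0::real"]
    proof eventually_elim
      case (elim \<epsilon>)
      interpret E: cvar_space "perturb Q \<epsilon> \<rho>" g \<alpha> using cv elim by blast
      show ?case unfolding ru[OF elim(2,1), symmetric] using E.CVaR_le_ru E.CVaR_eq_ru_VaR by blast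
    qed
  qed
  then show "has_right_derivative (\<lambda>R. CVaR \<alpha> R g) Q \<rho> (signed_integral \<rho> (h_fun \<alpha> g y0))"
    by (simp add: has_right_derivative_def diff_quotient_def[abs_def] I_def)
qed

text \<open>Exact expansion of the square, with a remainder \<epsilon> times a squared CVaR quotient
  that vanishes once this quotient converges. At \<epsilon> = 0 all quotients are 0 by
  convention.\<close>

lemma F_CVaR_diff_quotient:
  "diff_quotient (F_CVaR L lam \<alpha> g P) Q \<rho> \<epsilon> = diff_quotient (DKL_Lip_real L P) Q \<rho> \<epsilon>
     + lam * (\<epsilon> * (diff_quotient (\<lambda>R. CVaR \<alpha> R g) Q \<rho> \<epsilon>)\<^sup>2
              - 2 * Delta_C \<alpha> g P Q * diff_quotient (\<lambda>R. CVaR \<alpha> R g) Q \<rho> \<epsilon>)"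
proof (cases "\<epsilon> = 0")
  case False
  then show ?thesis
    by (simp add: diff_quotient_def F_CVaR_def Delta_C_def field_simps power2_eq_square)
qed (simp add: diff_quotient_def)

lemma F_CVaR_diff_quotient_tendsto:
  assumes "(diff_quotient (DKL_Lip_real L P) Q \<rho> \<longlongrightarrow> A) (at 0 within S)"
    and "(diff_quotient (\<lambda>R. CVaR \<alpha> R g) Q \<rho> \<longlongrightarrow> D) (at 0 within S)"
  shows "(diff_quotient (F_CVaR L lam \<alpha> g P) Q \<rho> \<longlongrightarrow> A - 2 * lam * Delta_C \<alpha> g P Q * D) (at 0 within S)"
proof -
  have "((\<lambda>\<epsilon>. diff_quotient (F_CVaR L lam \<alpha> g P) Q \<rho> \<epsilon>) \<longlongrightarrow> A + lam * (0 * D\<^sup>2 - 2 * Delta_C \<alpha> g P Q * D)) (at 0 within S)"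
    unfolding F_CVaR_diff_quotient by (intro tendsto_intros assms)
  then show ?thesis by (simp add: algebra_simps)
qed

section \<open>Lower bounds for the Clarke derivative\<close>

text \<open>The base point may move with t, so one statement serves both the constant curve Q and
  the curve Q - t \<rho>.\<close>

lemma clarke_sup_ge_limit:
  assumes ev: "\<forall>\<^sub>F t in at_right 0. Q' t \<in> borel_probs \<and> perturb_prob (Q' t) t \<rho> \<and> W1 (Q' t) Q < ennreal r"
    and r: "0 < r"
    and lim: "((\<lambda>t. (J (perturb (Q' t) t \<rho>) - J (Q' t)) / t) \<longlongrightarrow> D) (at_right 0)"
  shows "ereal D \<le> (SUP (Q', t)\<in>{(Q', t). Q' \<in> borel_probs \<and> perturb_prob Q' t \<rho> \<and>
                              W1 Q' Q < ennreal r \<and> 0 < t \<and> t < r}.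
          ereal ((J (perturb Q' t \<rho>) - J Q') / t))" (is "_ \<le> ?S")
proof (rule tendsto_upperbound)
  show "((\<lambda>t. ereal ((J (perturb (Q' t) t \<rho>) - J (Q' t)) / t)) \<longlongrightarrow> ereal D) (at_right 0)"
    using lim by simp
  have "\<forall>\<^sub>F t in at_right 0. t \<in> {0<..<r}" using r by (rule eventually_at_right_real)
  with ev show "\<forall>\<^sub>F t in at_right 0. ereal ((J (perturb (Q' t) t \<rho>) - J (Q' t)) / t) \<le> ?S"
    by eventually_elim (auto intro!: SUP_upper2[of "(Q' _, _)"])
qed simp

lemma perturb_perturb_uminus:
  assumes Q: "Q \<in> borel_probs" and s: "signed_measure \<rho>" and p: "perturb_prob Q (- t) \<rho>"
  shows "perturb (perturb Q (- t) \<rho>) t \<rho> = Q" and "perturb_prob (perturb Q (- t) \<rho>) t \<rho>"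
proof -
  interpret prob_space Q using Q by (simp add: borel_probs_iff)
  have sQ: "sets Q = sets borel" using Q by (simp add: borel_probs_iff)
  have R: "perturb Q (- t) \<rho> \<in> borel_probs" using p by (simp add: perturb_prob_def)
  have m: "measure (perturb Q (- t) \<rho>) A + t * \<rho> A = measure Q A" if "A \<in> sets borel" for A
    using measure_perturb[OF Q s p that] by simp
  show *: "perturb (perturb Q (- t) \<rho>) t \<rho> = Q"
    by (rule measure_eqI) (simp_all add: sQ emeasure_perturb[OF R s] m emeasure_eq_measure)
  show "perturb_prob (perturb Q (- t) \<rho>) t \<rho>"
    using Q by (simp add: perturb_prob_def * m)
qed

lemma
  fixes Q :: "'a::euclidean_space measure"
  assumes Q: "Q \<in> borel_probs" "finite_first_moment Q" and \<rho>: "admissible Q \<rho>"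
  shows clarke_ge_right: "has_right_derivative J Q \<rho> D \<Longrightarrow> ereal D \<le> clarke_derivative J Q \<rho>"
    and clarke_ge_left: "has_left_derivative J Q \<rho> D \<Longrightarrow> ereal D \<le> clarke_derivative J Q \<rho>"
proof -
  have r: "right_admissible Q \<rho>" "right_admissible Q (\<lambda>A. - \<rho> A)"
    using \<rho> by (auto simp: admissible_def left_admissible_def)
  show "ereal D \<le> clarke_derivative J Q \<rho>" if D: "has_right_derivative J Q \<rho> D"
    unfolding clarke_derivative_def
  proof (intro INF_greatest)
    fix e :: real assume e: "e \<in> {0<..}"
    show "ereal D \<le> (SUP (Q', t)\<in>{(Q', t). Q' \<in> borel_probs \<and> perturb_prob Q' t \<rho> \<and>
                              W1 Q' Q < ennreal e \<and> 0 < t \<and> t < e}.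
          ereal ((J (perturb Q' t \<rho>) - J Q') / t))"
      by (rule clarke_sup_ge_limit[where Q'="\<lambda>_. Q"])
         (use r(1) Q D e in \<open>auto simp: right_admissible_def W1_self has_right_derivative_def diff_quotient_def[abs_def]\<close>)
  qed
  show "ereal D \<le> clarke_derivative J Q \<rho>" if D: "has_left_derivative J Q \<rho> D"
    unfolding clarke_derivative_def
  proof (intro INF_greatest)
    fix e :: real assume e: "e \<in> {0<..}"
    have s: "signed_measure \<rho>" using r by (simp add: right_admissible_def)
    have ev: "\<forall>\<^sub>F t in at_right 0. perturb_prob Q (- t) \<rho>"
      using r(2) by (simp add: right_admissible_def perturb_prob_uminus)
    have lim: "((\<lambda>t. diff_quotient J Q \<rho> (- t)) \<longlongrightarrow> D) (at_right 0)"
      using D by (simp add: has_left_derivative_def filterlim_at_left_to_right)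
    show "ereal D \<le> (SUP (Q', t)\<in>{(Q', t). Q' \<in> borel_probs \<and> perturb_prob Q' t \<rho> \<and>
                              W1 Q' Q < ennreal e \<and> 0 < t \<and> t < e}.
          ereal ((J (perturb Q' t \<rho>) - J Q') / t))"
    proof (rule clarke_sup_ge_limit[where Q'="\<lambda>t. perturb Q (- t) \<rho>"])
      have "\<forall>\<^sub>F t in at_right 0. W1 (perturb Q (- t) \<rho>) Q < ennreal e"
        using eventually_W1_perturb_less[OF Q r(2), of e] e by (simp add: perturb_uminus)
      with ev show "\<forall>\<^sub>F t in at_right 0. perturb Q (- t) \<rho> \<in> borel_probs \<and>
          perturb_prob (perturb Q (- t) \<rho>) t \<rho> \<and> W1 (perturb Q (- t) \<rho>) Q < ennreal e"
        by eventually_elim (use Q perturb_perturb_uminus[OF Q(1) s] in \<open>auto simp: perturb_prob_def\<close>)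
      \<comment> \<open>The forward quotient based at Q - t \<rho> ends at Q, hence equals the
        quotient of J at Q for the step -t.\<close>
      from ev have "\<forall>\<^sub>F t in at_right 0. (J (perturb (perturb Q (- t) \<rho>) t \<rho>) - J (perturb Q (- t) \<rho>)) / t
          = diff_quotient J Q \<rho> (- t)"
        by eventually_elim (simp add: perturb_perturb_uminus[OF Q(1) s] diff_quotient_def divide_simps)
      with lim show "((\<lambda>t. (J (perturb (perturb Q (- t) \<rho>) t \<rho>) - J (perturb Q (- t) \<rho>)) / t) \<longlongrightarrow> D) (at_right 0)"
        by (simp cong: tendsto_cong)
    qed (use e in simp)
  qed
qed

section \<open>A direction that separates the points of T(Q)\<close>

lemma finite_first_moment_dominated:
  assumes R: "R \<in> borel_probs" and Q: "Q \<in> borel_probs" "finite_first_moment Q"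
    and le: "\<And>A. A \<in> sets borel \<Longrightarrow> measure R A \<le> c * measure Q A" and c: "0 \<le> c"
  shows "finite_first_moment R"
proof -
  have s: "sets R = sets borel" "sets Q = sets borel" and "prob_space R" "prob_space Q" using R Q by (auto simp: borel_probs_iff)
  interpret R: prob_space R by fact
  interpret Q: prob_space Q by fact
  have "1 * (\<integral>\<^sup>+x. norm x \<partial>R) + 0 * (\<integral>\<^sup>+x. norm x \<partial>R) \<le> ennreal c * (\<integral>\<^sup>+x. norm x \<partial>Q) + 0 * (\<integral>\<^sup>+x. norm x \<partial>R)"
    by (rule nn_integral_comb_mono[where M=borel])
       (use c le in \<open>auto simp: s R.emeasure_eq_measure Q.emeasure_eq_measure ennreal_mult[symmetric] intro!: ennreal_leI\<close>)
  also have "\<dots> < \<infinity>"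
    using Q(2) by (simp add: finite_first_moment_def integrable_iff_bounded ennreal_mult_less_top)
  finally have "(\<integral>\<^sup>+x. norm x \<partial>R) < \<infinity>" by simp
  then show ?thesis using s by (simp add: finite_first_moment_def integrable_iff_bounded cong: measurable_cong_sets)
qed

text \<open>Mass is moved from the upper tail \<open>{g > VaR}\<close> to the lower part \<open>{g \<le> VaR}\<close>, which has probability exactly
  \<open>\<alpha>\<close> when \<open>VaR < VaR_upper\<close>. On the conditioned measure every \<open>h_fun \<alpha> g y\<close> with \<open>y\<close> in \<open>T_set\<close> vanishes, and
  under \<open>Q\<close> its integral is \<open>CVaR - y\<close>.\<close>

lemma separating_perturbation:
  fixes g :: "'a::euclidean_space \<Rightarrow> real"
  assumes g: "K-lipschitz_on UNIV g" "\<And>x. 0 \<le> g x" and \<alpha>: "0 < \<alpha>" "\<alpha> < 1"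
    and Q: "Q \<in> borel_probs" "finite_first_moment Q" and less: "VaR \<alpha> Q g < VaR_upper \<alpha> Q g"
  obtains \<rho> where "admissible Q \<rho>" "\<not> (\<lambda>y. signed_integral \<rho> (h_fun \<alpha> g y)) constant_on T_set \<alpha> Q g"
proof -
  interpret Q: cvar_space Q g \<alpha>
    by (rule cvar_spaceI) (use integrable_lipschitz g Q \<alpha> in auto)
  define S where "S = {x. g x \<le> VaR \<alpha> Q g}"
  have S[measurable]: "S \<in> sets borel" by (simp add: S_def)
  \<comment> \<open>At least \<alpha> because VaR is attained, at most \<alpha> because VaR lies
    strictly below \<open>VaR_upper\<close>.\<close>
  have mS: "measure Q S = \<alpha>"
    using Q.Psi_VaR Q.Psi_le[OF less] by (simp add: S_def Psi_def)
  define \<rho> where "\<rho> A = measure Q (A \<inter> S) / \<alpha> - measure Q A" for A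
  have le: "measure Q (A \<inter> S) \<le> measure Q A" if "A \<in> sets borel" for A
    using that by (intro Q.finite_measure_mono) auto
  have s: "signed_measure \<rho>"
    unfolding signed_measure_def
  proof (intro conjI allI impI)
    fix A :: "nat \<Rightarrow> 'a set" assume *: "range A \<subseteq> sets borel" "disjoint_family A"
    have "(\<lambda>i. measure Q (A i)) sums measure Q (\<Union>i. A i)"
      using * by (intro Q.finite_measure_UNION) auto
    moreover have "(\<lambda>i. measure Q (A i \<inter> S)) sums measure Q (\<Union>i. A i \<inter> S)"
      using * by (intro Q.finite_measure_UNION) (auto simp: disjoint_family_on_def)
    ultimately show "(\<lambda>i. \<rho> (A i)) sums \<rho> (\<Union>i. A i)"
      unfolding \<rho>_def by (auto intro!: sums_diff sums_divide)
  qed (simp add: \<rho>_def)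
  have \<rho>U: "\<rho> UNIV = 0" using \<alpha> mS Q.prob_space by (simp add: \<rho>_def)
  have right: "perturb_prob Q \<epsilon> \<rho>" if "0 < \<epsilon>" "\<epsilon> \<le> 1" for \<epsilon>
  proof (rule perturb_probI[OF Q(1) s \<rho>U])
    fix A :: "'a set" assume "A \<in> sets borel"
    have "0 \<le> (1 - \<epsilon>) * measure Q A + \<epsilon> * measure Q (A \<inter> S) / \<alpha>" using that \<alpha> by simp
    then show "0 \<le> measure Q A + \<epsilon> * \<rho> A" by (simp add: \<rho>_def algebra_simps)
  qed
  \<comment> \<open>Conditioning on S multiplies mass by at most 1 / \<alpha>, so up to \<epsilon> =
    \<alpha> subtracting it leaves a nonnegative measure.\<close>
  have left: "perturb_prob Q \<epsilon> (\<lambda>A. - \<rho> A)" if "0 < \<epsilon>" "\<epsilon> \<le> \<alpha>" for \<epsilon>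
  proof (rule perturb_probI[OF Q(1) signed_measure_uminus[OF s]])
    fix A :: "'a set" assume A: "A \<in> sets borel"
    have "\<epsilon> * (measure Q (A \<inter> S) / \<alpha>) \<le> \<alpha> * (measure Q (A \<inter> S) / \<alpha>)"
      using that \<alpha> by (intro mult_right_mono) auto
    also have "\<dots> \<le> measure Q A" using \<alpha> le[OF A] by simp
    finally have "\<epsilon> * (measure Q (A \<inter> S) / \<alpha>) \<le> measure Q A" .
    moreover have "0 \<le> \<epsilon> * measure Q A" using that by simp
    ultimately show "0 \<le> measure Q A + \<epsilon> * - \<rho> A" by (simp add: \<rho>_def algebra_simps)
  qed (simp add: \<rho>U)
  define R where "R = perturb Q 1 \<rho>"
  have p1: "perturb_prob Q 1 \<rho>" by (rule right) auto
  have R: "R \<in> borel_probs" using p1 by (simp add: perturb_prob_def R_def)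
  have mR: "measure R A = measure Q (A \<inter> S) / \<alpha>" if "A \<in> sets borel" for A
    by (simp add: R_def measure_perturb[OF Q(1) s p1 that] \<rho>_def)
  have R1: "finite_first_moment R"
    by (rule finite_first_moment_dominated[OF R Q, where c="1 / \<alpha>"]) (use \<alpha> le in \<open>auto simp: mR divide_right_mono\<close>)
  have p2: "perturb_prob Q \<alpha> (\<lambda>A. - \<rho> A)" by (rule left) (use \<alpha> in auto)
  have R2: "finite_first_moment (perturb Q \<alpha> (\<lambda>A. - \<rho> A))"
  \<comment> \<open>The perturbed measure is at most (1 + \<alpha>) Q, hence at most 2 Q.\<close>
  proof (rule finite_first_moment_dominated[OF _ Q, where c=2])
    show "perturb Q \<alpha> (\<lambda>A. - \<rho> A) \<in> borel_probs" using p2 by (simp add: perturb_prob_def)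
    fix A :: "'a set" assume A: "A \<in> sets borel"
    have "\<alpha> * measure Q A \<le> 1 * measure Q A" using \<alpha> by (intro mult_right_mono) auto
    moreover have "measure (perturb Q \<alpha> (\<lambda>A. - \<rho> A)) A = measure Q A + \<alpha> * - \<rho> A"
      by (rule measure_perturb[OF Q(1) signed_measure_uminus[OF s] p2 A])
    moreover have "\<alpha> * - \<rho> A \<le> \<alpha> * measure Q A"
      using \<alpha> by (intro mult_left_mono) (simp_all add: \<rho>_def)
    ultimately show "measure (perturb Q \<alpha> (\<lambda>A. - \<rho> A)) A \<le> 2 * measure Q A" by linarith
  qed simp
  have "\<forall>\<^sub>F \<epsilon> in at_right 0. perturb_prob Q \<epsilon> \<rho>"
    using eventually_at_right_real[of 0 1] by (auto elim!: eventually_mono intro: right)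
  then have ra: "right_admissible Q \<rho>"
    by (rule right_admissibleI[OF Q s \<rho>U _ p1]) (use R1 in \<open>simp_all add: R_def\<close>)
  have ev: "\<forall>\<^sub>F \<epsilon> in at_right 0. perturb_prob Q \<epsilon> (\<lambda>A. - \<rho> A)"
    using eventually_at_right_real[of 0 \<alpha>] \<alpha> by (auto elim!: eventually_mono intro: left)
  have "right_admissible Q (\<lambda>A. - \<rho> A)"
    by (rule right_admissibleI[OF Q signed_measure_uminus[OF s] _ ev p2]) (use R2 \<alpha> \<rho>U in auto)
  with ra have adm: "admissible Q \<rho>" by (simp add: admissible_def left_admissible_def)
  interpret R: cvar_space R g \<alpha>
    by (rule cvar_spaceI) (use integrable_lipschitz g R R1 \<alpha> in auto)
  have I: "signed_integral \<rho> (h_fun \<alpha> g y) = y - CVaR \<alpha> Q g" if y: "y \<in> T_set \<alpha> Q g" for y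
  proof -
    have "measure R (- S) = 0" by (subst mR) auto
    then have "AE x in R. x \<in> S"
      by (intro AE_I[of _ _ "- S"]) (auto simp: R.emeasure_eq_measure)
    then have "AE x in R. h_fun \<alpha> g y x = 0"
      by eventually_elim (use y in \<open>auto simp: S_def h_fun_def T_set_def\<close>)
    then have "(\<integral>x. h_fun \<alpha> g y x \<partial>R) = 0" by (rule integral_eq_zero_AE)
    moreover have "(\<integral>x. h_fun \<alpha> g y x \<partial>R) = (\<integral>x. h_fun \<alpha> g y x \<partial>Q) + 1 * signed_integral \<rho> (h_fun \<alpha> g y)"
      using Q.h_fun_integrable R.h_fun_integrable unfolding R_def by (intro integral_perturb[OF Q(1) s p1]) auto
    ultimately show ?thesis using Q.CVaR_eq_ru[OF y] by (simp add: ru_objective_def)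
  qed
  \<comment> \<open>The integral is strictly increasing in y, so the two ends of T(Q) already give
    different values.\<close>
  have "VaR \<alpha> Q g \<in> T_set \<alpha> Q g" "VaR_upper \<alpha> Q g \<in> T_set \<alpha> Q g" using less by (auto simp: T_set_def)
  then have "\<not> (\<lambda>y. signed_integral \<rho> (h_fun \<alpha> g y)) constant_on T_set \<alpha> Q g"
    using less I unfolding constant_on_def by (metis diff_add_cancel less_irrefl)
  with adm show thesis by (rule that)
qed

section \<open>One-sided derivatives, subgradients and Gateaux differentiability of the
  functional\<close>

theorem theorem3p7:
  fixes g \<phi> :: "'a::euclidean_space \<Rightarrow> real"
    and P Q :: "'a measure"
    and \<alpha> lam L :: real
  assumes g_nonneg: "\<And>x. 0 \<le> g x"
    and g_lipschitz: "\<exists>K. K-lipschitz_on UNIV g"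
    and \<alpha>: "0 < \<alpha>" "\<alpha> < 1"
    and lam: "0 < lam"
    and L: "0 < L"
    and P: "P \<in> borel_probs"
    and Q: "Q \<in> borel_probs"
    and P_g: "integrable P g"
    and Q_g: "integrable Q g"
    and Q_moment: "finite_first_moment Q"
    and \<phi>_max: "dual_maximizer L Q P \<phi>"
    and \<phi>_var: "first_variation (DKL_Lip_real L P) Q \<phi>"
  shows
    "(\<forall>\<rho>. right_admissible Q \<rho> \<longrightarrow>
        (\<exists>y0\<in>T_set \<alpha> Q g.
           (\<forall>y\<in>T_set \<alpha> Q g. signed_integral \<rho> (h_fun \<alpha> g y0) \<le> signed_integral \<rho> (h_fun \<alpha> g y)) \<and>
           has_right_derivative (F_CVaR L lam \<alpha> g P) Q \<rho>
             (signed_integral \<rho> \<phi>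
                - 2 * lam * Delta_C \<alpha> g P Q * signed_integral \<rho> (h_fun \<alpha> g y0))))
     \<and>
     (\<forall>\<rho>. left_admissible Q \<rho> \<longrightarrow>
        (\<exists>y0\<in>T_set \<alpha> Q g.
           (\<forall>y\<in>T_set \<alpha> Q g. signed_integral \<rho> (h_fun \<alpha> g y) \<le> signed_integral \<rho> (h_fun \<alpha> g y0)) \<and>
           has_left_derivative (F_CVaR L lam \<alpha> g P) Q \<rho>
             (signed_integral \<rho> \<phi>
                - 2 * lam * Delta_C \<alpha> g P Q * signed_integral \<rho> (h_fun \<alpha> g y0))))
     \<and>
     (\<forall>\<rho>. admissible Q \<rho> \<longrightarrow>
        (\<lambda>y. signed_integral \<rho> (Phi_fun lam \<alpha> g P Q \<phi> y)) ` T_set \<alpha> Q g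
          = closed_segment (left_derivative (F_CVaR L lam \<alpha> g P) Q \<rho>)
                           (right_derivative (F_CVaR L lam \<alpha> g P) Q \<rho>))
     \<and>
     (\<forall>y\<in>T_set \<alpha> Q g.
        variational_subgradient (F_CVaR L lam \<alpha> g P) Q (Phi_fun lam \<alpha> g P Q \<phi> y))
     \<and>
     (\<forall>\<rho>. admissible Q \<rho> \<longrightarrow>
        ((\<exists>D. has_gateaux_derivative (F_CVaR L lam \<alpha> g P) Q \<rho> D) \<longleftrightarrow>
           Delta_C \<alpha> g P Q = 0 \<or>
           (\<lambda>y. signed_integral \<rho> (h_fun \<alpha> g y)) constant_on T_set \<alpha> Q g))
     \<and>
     ((\<forall>\<rho>. admissible Q \<rho> \<longrightarrow> (\<exists>D. has_gateaux_derivative (F_CVaR L lam \<alpha> g P) Q \<rho> D)) \<longleftrightarrow>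
        Delta_C \<alpha> g P Q = 0 \<or> is_singleton (T_set \<alpha> Q g))
     \<and>
     (Delta_C \<alpha> g P Q = 0 \<or> is_singleton (T_set \<alpha> Q g) \<longrightarrow>
        (\<forall>\<rho>. admissible Q \<rho> \<longrightarrow>
           has_gateaux_derivative (F_CVaR L lam \<alpha> g P) Q \<rho>
             (signed_integral \<rho> (Phi_fun lam \<alpha> g P Q \<phi> (VaR \<alpha> Q g)))))"
proof -
  obtain K where g: "K-lipschitz_on UNIV g" using g_lipschitz by blast
  interpret Q: cvar_space Q g \<alpha> by (rule cvar_spaceI) fact+
  define T where "T = T_set \<alpha> Q g"
  define c where "c = 2 * lam * Delta_C \<alpha> g P Q"
  define v where "v = VaR \<alpha> Q g"
  let ?F = "F_CVaR L lam \<alpha> g P"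
  let ?I = "\<lambda>\<rho> y. signed_integral \<rho> (h_fun \<alpha> g y)"
  let ?\<Phi> = "\<lambda>\<rho> y. signed_integral \<rho> (Phi_fun lam \<alpha> g P Q \<phi> y)"
  have T: "T = {VaR \<alpha> Q g..VaR_upper \<alpha> Q g}" by (simp add: T_def T_set_def)
  have vT: "v \<in> T" using Q.VaR_le_upper by (simp add: T v_def)
  have c0: "c = 0 \<longleftrightarrow> Delta_C \<alpha> g P Q = 0" using lam by (simp add: c_def)
  have single: "T = {v}" if "is_singleton T" using that vT by (auto simp: is_singleton_def)
  have right: "\<exists>y0\<in>T. (\<forall>y\<in>T. ?I \<rho> y0 \<le> ?I \<rho> y) \<and> has_right_derivative ?F Q \<rho> (signed_integral \<rho> \<phi> - c * ?I \<rho> y0)"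
    if \<rho>: "right_admissible Q \<rho>" for \<rho>
  proof -
    have "continuous_on T (?I \<rho>)"
      using continuous_on_signed_integral_h_fun[OF g g_nonneg \<alpha> Q Q_moment \<rho>] continuous_on_subset by blast
    then obtain y0 where y0: "y0 \<in> T" "\<forall>y\<in>T. ?I \<rho> y0 \<le> ?I \<rho> y"
      using continuous_attains_inf[of T "?I \<rho>"] vT by (auto simp: T)
    have "has_right_derivative (\<lambda>R. CVaR \<alpha> R g) Q \<rho> (?I \<rho> y0)"
      by (rule CVaR_has_right_derivative[OF g g_nonneg \<alpha> Q Q_moment \<rho>]) (use y0 in \<open>auto simp: T_def\<close>)
    then have "has_right_derivative ?F Q \<rho> (signed_integral \<rho> \<phi> - c * ?I \<rho> y0)"
      using \<phi>_var \<rho> unfolding has_right_derivative_def first_variation_def c_def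
      by (intro F_CVaR_diff_quotient_tendsto) auto
    with y0 show ?thesis by blast
  qed
  have left: "\<exists>y1\<in>T. (\<forall>y\<in>T. ?I \<rho> y \<le> ?I \<rho> y1) \<and> has_left_derivative ?F Q \<rho> (signed_integral \<rho> \<phi> - c * ?I \<rho> y1)"
    if \<rho>: "left_admissible Q \<rho>" for \<rho>
  proof -
    have \<rho>': "right_admissible Q (\<lambda>A. - \<rho> A)" using \<rho> by (simp add: left_admissible_def)
    have "continuous_on T (?I (\<lambda>A. - \<rho> A))"
      using continuous_on_signed_integral_h_fun[OF g g_nonneg \<alpha> Q Q_moment \<rho>'] continuous_on_subset by blast
    then obtain y1 where y1: "y1 \<in> T" "\<forall>y\<in>T. ?I (\<lambda>A. - \<rho> A) y1 \<le> ?I (\<lambda>A. - \<rho> A) y"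
      using continuous_attains_inf[of T "?I (\<lambda>A. - \<rho> A)"] vT by (auto simp: T)
    have "has_right_derivative (\<lambda>R. CVaR \<alpha> R g) Q (\<lambda>A. - \<rho> A) (?I (\<lambda>A. - \<rho> A) y1)"
      by (rule CVaR_has_right_derivative[OF g g_nonneg \<alpha> Q Q_moment \<rho>']) (use y1 in \<open>auto simp: T_def\<close>)
    then have "has_left_derivative (\<lambda>R. CVaR \<alpha> R g) Q \<rho> (?I \<rho> y1)"
      by (simp add: has_left_derivative_uminus signed_integral_uminus)
    then have "has_left_derivative ?F Q \<rho> (signed_integral \<rho> \<phi> - c * ?I \<rho> y1)"
      using \<phi>_var \<rho> unfolding has_left_derivative_def first_variation_def c_def
      by (intro F_CVaR_diff_quotient_tendsto) auto
    with y1 show ?thesis by (auto simp: signed_integral_uminus)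
  qed
  \<comment> \<open>Splitting the integral requires \<phi> and \<open>h_fun\<close> to be integrable
    under both Jordan parts; this follows from their Lipschitz continuity and the first moments of Q
    and Q + t \<rho>.\<close>
  have \<Phi>: "?\<Phi> \<rho> y = signed_integral \<rho> \<phi> - c * ?I \<rho> y" if \<rho>: "right_admissible Q \<rho>" for \<rho> y
  proof -
    obtain t where t: "0 < t" "perturb_prob Q t \<rho>" using right_admissible_ex[OF \<rho>] by blast
    have s: "signed_measure \<rho>" using \<rho> by (simp add: right_admissible_def)
    have R: "perturb Q t \<rho> \<in> borel_probs" "finite_first_moment (perturb Q t \<rho>)"
      using t finite_first_moment_perturb[OF Q Q_moment \<rho> t(2,1)] by (auto simp: perturb_prob_def)
    have \<phi>: "L-lipschitz_on UNIV \<phi>" using \<phi>_max by (simp add: dual_maximizer_def Gamma_Lip_def)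
    note i = integrable_lipschitz[OF \<phi> Q Q_moment] integrable_lipschitz[OF \<phi> R]
    note j = integrable_lipschitz[OF lipschitz_h_fun[OF g \<alpha>(2)] Q Q_moment, of y]
      integrable_lipschitz[OF lipschitz_h_fun[OF g \<alpha>(2)] R, of y]
    note u = integrable_upper_variation[OF Q s t(2,1)] integrable_lower_variation[OF Q s t(2,1)]
    show ?thesis
      using u[OF i] u[OF j]
      by (simp add: signed_integral_def Phi_fun_def[abs_def] c_def algebra_simps)
  qed
  have extreme: "\<exists>y0\<in>T. \<exists>y1\<in>T. (\<forall>y\<in>T. ?I \<rho> y0 \<le> ?I \<rho> y \<and> ?I \<rho> y \<le> ?I \<rho> y1) \<and>
      has_right_derivative ?F Q \<rho> (?\<Phi> \<rho> y0) \<and> has_left_derivative ?F Q \<rho> (?\<Phi> \<rho> y1) \<and>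
      (\<forall>y\<in>T. ?\<Phi> \<rho> y \<in> closed_segment (?\<Phi> \<rho> y1) (?\<Phi> \<rho> y0))"
    if \<rho>: "admissible Q \<rho>" for \<rho>
  proof -
    have r: "right_admissible Q \<rho>" and l: "left_admissible Q \<rho>" using \<rho> by (auto simp: admissible_def)
    obtain y0 where y0: "y0 \<in> T" "\<forall>y\<in>T. ?I \<rho> y0 \<le> ?I \<rho> y" "has_right_derivative ?F Q \<rho> (?\<Phi> \<rho> y0)"
      using right[OF r] unfolding \<Phi>[OF r] by blast
    obtain y1 where y1: "y1 \<in> T" "\<forall>y\<in>T. ?I \<rho> y \<le> ?I \<rho> y1" "has_left_derivative ?F Q \<rho> (?\<Phi> \<rho> y1)"
      using left[OF l] unfolding \<Phi>[OF r] by blast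
    \<comment> \<open>A negative c reverses the order of the two endpoints, hence the unordered
      segment and the case split.\<close>
    have "?\<Phi> \<rho> y \<in> closed_segment (?\<Phi> \<rho> y1) (?\<Phi> \<rho> y0)" if "y \<in> T" for y
    proof (cases "0 \<le> c")
      case True
      then have "c * ?I \<rho> y0 \<le> c * ?I \<rho> y" "c * ?I \<rho> y \<le> c * ?I \<rho> y1"
        using y0 y1 that by (auto intro: mult_left_mono)
      then show ?thesis by (auto simp: closed_segment_eq_real_ivl \<Phi>[OF r])
    next
      case False
      then have "c * ?I \<rho> y \<le> c * ?I \<rho> y0" "c * ?I \<rho> y1 \<le> c * ?I \<rho> y"
        using y0 y1 that by (auto intro: mult_left_mono_neg)
      then show ?thesis by (auto simp: closed_segment_eq_real_ivl \<Phi>[OF r])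
    qed
    with y0 y1 show ?thesis by blast
  qed
  have gateaux: "has_gateaux_derivative ?F Q \<rho> D \<longleftrightarrow> has_left_derivative ?F Q \<rho> D \<and> has_right_derivative ?F Q \<rho> D" for \<rho> D
    by (simp add: has_gateaux_derivative_def has_left_derivative_def has_right_derivative_def filterlim_at_split)
  have image: "?\<Phi> \<rho> ` T = closed_segment (left_derivative ?F Q \<rho>) (right_derivative ?F Q \<rho>)"
    if \<rho>: "admissible Q \<rho>" for \<rho>
  proof -
    have r: "right_admissible Q \<rho>" using \<rho> by (simp add: admissible_def)
    obtain y0 y1 where y: "y0 \<in> T" "y1 \<in> T" "has_right_derivative ?F Q \<rho> (?\<Phi> \<rho> y0)"
      "has_left_derivative ?F Q \<rho> (?\<Phi> \<rho> y1)" "\<forall>y\<in>T. ?\<Phi> \<rho> y \<in> closed_segment (?\<Phi> \<rho> y1) (?\<Phi> \<rho> y0)"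
      using extreme[OF \<rho>] by blast
    have D: "left_derivative ?F Q \<rho> = ?\<Phi> \<rho> y1" "right_derivative ?F Q \<rho> = ?\<Phi> \<rho> y0"
      using y(3,4) by (auto simp: left_derivative_def right_derivative_def has_left_derivative_def
          has_right_derivative_def intro!: tendsto_Lim)
    \<comment> \<open>A connected subset of the line is convex; as the values at y0 and y1 are the
      two derivatives, the image fills the whole segment between them.\<close>
    have "continuous_on T (?\<Phi> \<rho>)"
      unfolding \<Phi>[OF r] using continuous_on_subset[OF continuous_on_signed_integral_h_fun[OF g g_nonneg \<alpha> Q Q_moment r], of T]
      by (intro continuous_intros) auto
    then have "connected (?\<Phi> \<rho> ` T)"
      by (rule connected_continuous_image) (simp add: T)
    then have "convex (?\<Phi> \<rho> ` T)"
      by (metis is_interval_connected_1 is_interval_convex_1)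
    then have "closed_segment (?\<Phi> \<rho> y1) (?\<Phi> \<rho> y0) \<subseteq> ?\<Phi> \<rho> ` T"
      using y(1,2) by (intro closed_segment_subset) auto
    with y(5) D show ?thesis by auto
  qed
  have subgrad: "variational_subgradient ?F Q (Phi_fun lam \<alpha> g P Q \<phi> y)" if y: "y \<in> T" for y
    unfolding variational_subgradient_def
  proof (intro conjI allI impI)
    show "locally_Lipschitz_W1 ?F Q" by (rule F_CVaR_locally_Lipschitz) fact+
    fix \<rho> assume \<rho>: "admissible Q \<rho>"
    obtain y0 y1 where "has_right_derivative ?F Q \<rho> (?\<Phi> \<rho> y0)" "has_left_derivative ?F Q \<rho> (?\<Phi> \<rho> y1)"
      and seg: "?\<Phi> \<rho> y \<in> closed_segment (?\<Phi> \<rho> y1) (?\<Phi> \<rho> y0)"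
      using extreme[OF \<rho>] y by blast
    then have "ereal (?\<Phi> \<rho> y0) \<le> clarke_derivative ?F Q \<rho>" "ereal (?\<Phi> \<rho> y1) \<le> clarke_derivative ?F Q \<rho>"
      using clarke_ge_right[OF Q Q_moment \<rho>] clarke_ge_left[OF Q Q_moment \<rho>] by blast+
    \<comment> \<open>A point of a segment is at most the larger endpoint, and both endpoints are
      below the Clarke derivative.\<close>
    moreover have "?\<Phi> \<rho> y \<le> ?\<Phi> \<rho> y0 \<or> ?\<Phi> \<rho> y \<le> ?\<Phi> \<rho> y1"
      using seg by (auto simp: closed_segment_eq_real_ivl split: if_splits)
    ultimately show "ereal (?\<Phi> \<rho> y) \<le> clarke_derivative ?F Q \<rho>"
      by (meson ereal_less_eq(3) order_trans)
  qed
  have iff: "(\<exists>D. has_gateaux_derivative ?F Q \<rho> D) \<longleftrightarrow> Delta_C \<alpha> g P Q = 0 \<or> ?I \<rho> constant_on T"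
    and gateaux_value: "Delta_C \<alpha> g P Q = 0 \<or> ?I \<rho> constant_on T \<Longrightarrow> has_gateaux_derivative ?F Q \<rho> (?\<Phi> \<rho> v)"
    if \<rho>: "admissible Q \<rho>" for \<rho>
  proof -
    have r: "right_admissible Q \<rho>" using \<rho> by (simp add: admissible_def)
    obtain y0 y1 where y: "y0 \<in> T" "y1 \<in> T" "\<forall>y\<in>T. ?I \<rho> y0 \<le> ?I \<rho> y \<and> ?I \<rho> y \<le> ?I \<rho> y1"
      and D: "has_right_derivative ?F Q \<rho> (?\<Phi> \<rho> y0)" "has_left_derivative ?F Q \<rho> (?\<Phi> \<rho> y1)"
      using extreme[OF \<rho>] by blast
    show gateaux_value: "has_gateaux_derivative ?F Q \<rho> (?\<Phi> \<rho> v)" if "Delta_C \<alpha> g P Q = 0 \<or> ?I \<rho> constant_on T"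
    proof -
      have "c = 0 \<or> (?I \<rho> y0 = ?I \<rho> v \<and> ?I \<rho> y1 = ?I \<rho> v)"
        using that y(1,2) vT unfolding c0 constant_on_def by metis
      then have "?\<Phi> \<rho> y0 = ?\<Phi> \<rho> v" "?\<Phi> \<rho> y1 = ?\<Phi> \<rho> v" by (auto simp: \<Phi>[OF r])
      with D show ?thesis by (simp add: gateaux)
    qed
    have "Delta_C \<alpha> g P Q = 0 \<or> ?I \<rho> constant_on T" if "has_gateaux_derivative ?F Q \<rho> E" for E
    proof -
      have "E = ?\<Phi> \<rho> y0" "E = ?\<Phi> \<rho> y1"
        using that D unfolding gateaux has_left_derivative_def has_right_derivative_def
        by (auto intro: tendsto_unique[rotated])
      \<comment> \<open>The one-sided derivatives coincide, so unless c = 0 the least and the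
        greatest integral over T(Q) agree and the integral is constant.\<close>
      then have "c * ?I \<rho> y0 = c * ?I \<rho> y1" unfolding \<Phi>[OF r] by linarith
      then have "c = 0 \<or> ?I \<rho> y0 = ?I \<rho> y1" by simp
      then show ?thesis
        unfolding c0 constant_on_def using y(3) by (metis order_antisym)
    qed
    with gateaux_value show "(\<exists>D. has_gateaux_derivative ?F Q \<rho> D) \<longleftrightarrow> Delta_C \<alpha> g P Q = 0 \<or> ?I \<rho> constant_on T"
      by blast
  qed
  have const: "?I \<rho> constant_on T" if "is_singleton T" for \<rho>
    using single[OF that] by (simp add: constant_on_def)
  have all_iff: "(\<forall>\<rho>. admissible Q \<rho> \<longrightarrow> (\<exists>D. has_gateaux_derivative ?F Q \<rho> D)) \<longleftrightarrow>
      Delta_C \<alpha> g P Q = 0 \<or> is_singleton T"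
  proof
    assume *: "\<forall>\<rho>. admissible Q \<rho> \<longrightarrow> (\<exists>D. has_gateaux_derivative ?F Q \<rho> D)"
    show "Delta_C \<alpha> g P Q = 0 \<or> is_singleton T"
    proof (cases "VaR \<alpha> Q g < VaR_upper \<alpha> Q g")
      case True
      obtain \<rho> where "admissible Q \<rho>" "\<not> ?I \<rho> constant_on T"
        using separating_perturbation[OF g g_nonneg \<alpha> Q Q_moment True] unfolding T_def by blast
      then show ?thesis using * iff by blast
    next
      case False
      then have "T = {v}" using Q.VaR_le_upper by (auto simp: T v_def)
      then show ?thesis by simp
    qed
  qed (use iff const in blast)
  show ?thesis
    using right left image subgrad iff all_iff gateaux_value const
    unfolding T_def c_def v_def by blast
qed

end
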